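(* Let $F$ be a norm form associated to a number field of degree $r\ge2$. Let $N\ge3$ be an integer and $B\ge1$. If $A\subseteq[N]^r$ satisfies $R_{A,F}(q)\le B$ for every $q\in\mathbb Z$, then there exists $c_F>0$, depending only on $F$, such that $$|A|\ll_F\sqrt{B}\,N^{r/2}\exp\left(-c_F\frac{\log N}{\log\log N}\right).$$
   Context: $[N]=\{1,\ldots,N\}$. Let $K$ be a number field of degree $r$ with ring of integers $\mathcal O_K$. A homogeneous polynomial $F\in\mathbb Z[x_1,\ldots,x_r]$ is a norm form associated to $K$ if there are $\omega_1,\ldots,\omega_r\in\mathcal O_K$, spanning a full-rank $\mathbb Z$-module, such that $F(x_1,\ldots,x_r)=N_{K/\mathbb Q}(x_1\omega_1+\cdots+x_r\omega_r)$ for all $(x_1,\ldots,x_r)\in\mathbb Z^r$. For $A\subseteq[N]^r$ and $q\in\mathbb Z$, $R_{A,F}(q):=\#\{(a,b)\in A^2: a\ne b,\ F(a-b)=q\}$. $X\ll_F Y$ means $X\le CY$ with $C>0$ depending only on $F$. The constants are independent of $N$, $A$, $B$. *)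

theory Defs
  imports
    Complex_Main
    "HOL-Library.FuncSet"
    "HOL-Library.Poly_Mapping"
    "HOL-Computational_Algebra.Polynomial"
    "Jordan_Normal_Form.Determinant"
begin

global_interpretation rat_vs: vector_space "\<lambda>(q::rat) (x::'k::field_char_0). of_rat q * x"
  by unfold_locales (simp_all add: algebra_simps of_rat_add of_rat_mult)

text \<open>A number field is a subfield of some ambient field of characteristic 0 that is
  finite-dimensional over the rationals. The ambient type is arbitrary: it may be the
  field itself (with \<open>K = UNIV\<close>), or for instance the complex numbers.\<close>

definition number_field :: "'k::field_char_0 set \<Rightarrow> bool" where
  "number_field K \<longleftrightarrow>
     1 \<in> K \<and> (\<forall>x\<in>K. \<forall>y\<in>K. x - y \<in> K \<and> x * y \<in> K) \<and> (\<forall>x\<in>K. inverse x \<in> K) \<and>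
     (\<exists>S. finite S \<and> rat_vs.span S = K)"

definition degree_nf :: "'k::field_char_0 set \<Rightarrow> nat" where
  "degree_nf K = rat_vs.dim K"

definition ring_of_integers :: "'k::field_char_0 set \<Rightarrow> 'k set" where
  "ring_of_integers K = {x \<in> K. algebraic_int x}"

definition rat_basis :: "'k::field_char_0 set \<Rightarrow> 'k list \<Rightarrow> bool" where
  "rat_basis K bs \<longleftrightarrow>
     distinct bs \<and> rat_vs.independent (set bs) \<and> rat_vs.span (set bs) = K"

definition mult_matrix :: "'k::field_char_0 list \<Rightarrow> 'k \<Rightarrow> rat mat" where
  "mult_matrix bs x =
     mat (length bs) (length bs)
       (\<lambda>(i, j). rat_vs.representation (set bs) (x * bs ! j) (bs ! i))"

text \<open>The norm from \<open>K\<close> to the rationals is the determinant of multiplication by \<open>x\<close> on \<open>K\<close>.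
  The determinant does not depend on the basis, so an unspecified one is used.\<close>

definition field_norm :: "'k::field_char_0 set \<Rightarrow> 'k \<Rightarrow> rat" where
  "field_norm K x = det (mult_matrix (SOME bs. rat_basis K bs) x)"

text \<open>Integer polynomials in variables indexed by natural numbers: a finitely supported map
  from monomials, which are finitely supported exponent vectors, to coefficients.\<close>

type_synonym int_mpoly = "(nat \<Rightarrow>\<^sub>0 nat) \<Rightarrow>\<^sub>0 int"

definition eval_mpoly :: "int_mpoly \<Rightarrow> (nat \<Rightarrow> int) \<Rightarrow> int" where
  "eval_mpoly F x =
     (\<Sum>m \<in> Poly_Mapping.keys F. Poly_Mapping.lookup F m *
        (\<Prod>i \<in> Poly_Mapping.keys m. x i ^ Poly_Mapping.lookup m i))"

definition mpoly_in_vars :: "nat set \<Rightarrow> int_mpoly \<Rightarrow> bool" where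
  "mpoly_in_vars V F \<longleftrightarrow> (\<forall>m \<in> Poly_Mapping.keys F. Poly_Mapping.keys m \<subseteq> V)"

definition homogeneous_mpoly :: "int_mpoly \<Rightarrow> bool" where
  "homogeneous_mpoly F \<longleftrightarrow>
     (\<exists>d. \<forall>m \<in> Poly_Mapping.keys F.
        (\<Sum>i \<in> Poly_Mapping.keys m. Poly_Mapping.lookup m i) = d)"

definition int_span :: "nat \<Rightarrow> (nat \<Rightarrow> 'k::field_char_0) \<Rightarrow> 'k set" where
  "int_span r \<omega> = {(\<Sum>i = 1..r. of_int (n i) * \<omega> i) |n :: nat \<Rightarrow> int. True}"

text \<open>The rank of a subgroup of the additive group of a field of characteristic 0 is the
  dimension of its rational span, which is what \<open>rat_vs.dim\<close> computes for an arbitrary set.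
  Full rank means that this equals the degree of \<open>K\<close>.\<close>

definition norm_form :: "'k::field_char_0 set \<Rightarrow> int_mpoly \<Rightarrow> bool" where
  "norm_form K F \<longleftrightarrow>
     mpoly_in_vars {1..degree_nf K} F \<and> homogeneous_mpoly F \<and>
     (\<exists>\<omega>. (\<forall>i\<in>{1..degree_nf K}. \<omega> i \<in> ring_of_integers K) \<and>
          rat_vs.dim (int_span (degree_nf K) \<omega>) = degree_nf K \<and>
          (\<forall>x :: nat \<Rightarrow> int.
             of_int (eval_mpoly F x)
               = field_norm K (\<Sum>i = 1..degree_nf K. of_int (x i) * \<omega> i)))"

text \<open>Vectors are functions on \<open>{1..r}\<close> that are \<open>undefined\<close> elsewhere; the values of
  \<open>\<lambda>i. a i - b i\<close> outside \<open>{1..r}\<close> are irrelevant when \<open>F\<close> is a polynomial in those variables.\<close>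

definition grid :: "nat \<Rightarrow> nat \<Rightarrow> (nat \<Rightarrow> int) set" where
  "grid r N = {1..r} \<rightarrow>\<^sub>E {1..int N}"

definition rep_count :: "(nat \<Rightarrow> int) set \<Rightarrow> int_mpoly \<Rightarrow> int \<Rightarrow> nat" where
  "rep_count A F q =
     card {(a, b). a \<in> A \<and> b \<in> A \<and> a \<noteq> b \<and> eval_mpoly F (\<lambda>i. a i - b i) = q}"

end

theory Submission
  imports
    Defs
    "HOL-Computational_Algebra.Computational_Algebra"
    "HOL-Analysis.Convex"
    "HOL-Real_Asymp.Real_Asymp"
    "Jordan_Normal_Form.Char_Poly"
begin

text \<open>
Distributing the pairs of \<open>A\<close> over the \<open>O(N^r)\<close> possible values of \<open>F\<close>, each taken at most
\<open>B\<close> times, gives \<open>|A|^2 \<lless> B N^r\<close>. The saving comes from looking only at values of \<open>F\<close> that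
are divisible by a fixed integer \<open>Q\<close>, in a way that uses the many ideals of norm \<open>Q\<close>.

Let \<open>p\<close> be an unramified prime below a prime ideal \<open>\<pp>\<close> of degree one. The ideals \<open>\<pp>^r\<close> and
\<open>(p)\<close> both have index \<open>p^r\<close>, all norms from either are multiples of \<open>p^r\<close>, and as \<open>r \<ge> 2\<close> the
norms from their intersection are multiples of \<open>p^(r+1)\<close>. Take a set \<open>P\<close> of \<open>k\<close> such primes and
put \<open>Q = \<Prod>p\<in>P. p^r\<close>. Choosing one of the two ideals for every \<open>p\<close> yields \<open>2^k\<close> lattices of index
\<open>Q\<close>, and by Cauchy-Schwarz at least \<open>|A|^2 / Q\<close> pairs of \<open>A\<close> are congruent modulo each of them.
Conversely a difference \<open>d\<close> lies in one of these lattices only if \<open>F(d) = Q m\<close>, and then in at most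
\<open>2^#{p\<in>P. p dvd m}\<close> of them, which for a typical \<open>m\<close> is much less than \<open>2^k\<close>: the average over
\<open>m\<close> is at most \<open>\<Prod>p\<in>P. 1 + 1/p \<le> (3/2)^k\<close>. Since every value has at most \<open>B\<close> representations,
\<open>|A|^2 \<le> Q |A| + B Q + 2 B X (3/4)^k\<close>,
where \<open>X = O(N^r)\<close> bounds \<open>|F|\<close> (lemma \<open>card_le_two_lattices\<close>).

The theorem follows if \<open>Q \<le> sqrt N\<close> is possible with \<open>k\<close> of order \<open>log N / log log N\<close>, that is, with
primes bounded by a fixed power of \<open>log N\<close>. So it suffices that at least
\<open>y^\<delta>\<close> of the primes up to \<open>y\<close> lie below a prime of degree one (\<open>many_primes_with_roots\<close>). These are
the primes dividing a value of the minimal polynomial \<open>f\<close> of an integral primitive element \<open>\<theta>\<close>, and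
if they were too rare, a product of \<open>X\<close> values of \<open>f\<close> along a progression would be too small.

In coordinates, this takes the following form. By Hensel's lemma there is an integer \<open>a\<close> with
\<open>p^r dvd f(a)\<close>, and \<open>\<theta> \<mapsto> a\<close> defines a ring homomorphism from \<open>\<int>[\<theta>]\<close> to the integers modulo \<open>p^r\<close>; its kernel plays
the part of \<open>\<pp>^r\<close>. The row \<open>(1, a, ..., a^(r-1))\<close> is an eigenvector of every multiplication matrix
modulo \<open>p^r\<close>, so norms of elements of the kernel vanish modulo \<open>p^r\<close> (\<open>field_norm_int_eval_dvd\<close>).
\<close>

section \<open>Averaging over lattices of equal index\<close>

lemma card_sq_le_collisions:
  fixes \<kappa> :: "'a \<Rightarrow> 'c"
  assumes A: "finite A" and n: "card (\<kappa> ` A) \<le> n"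
  shows "(card A)\<^sup>2 \<le> n * card {(a, b). a \<in> A \<and> b \<in> A \<and> \<kappa> a = \<kappa> b}"
proof -
  let ?fib = "\<lambda>c. {a \<in> A. \<kappa> a = c}"
  let ?x = "\<lambda>c. card (?fib c)"
  have fin: "finite (\<kappa> ` A)" using A by simp
  have "card A = (\<Sum>c\<in>\<kappa> ` A. ?x c)"
    using A by (subst card_UN_disjoint[symmetric]) (auto intro!: arg_cong[of _ _ card])
  hence "(card A)\<^sup>2 = (\<Sum>c\<in>\<kappa> ` A. ?x c)\<^sup>2" by simp
  also have "\<dots> \<le> n * (\<Sum>c\<in>\<kappa> ` A. (?x c)\<^sup>2)"
  proof -
    have "(\<Sum>c\<in>\<kappa> ` A. real (?x c))\<^sup>2 \<le> (\<Sum>c\<in>\<kappa> ` A. (real (?x c))\<^sup>2) * card (\<kappa> ` A)"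
      using sum_squared_le_sum_of_squares[of "\<lambda>c. real (?x c)" "\<kappa> ` A"] by simp
    hence "real ((\<Sum>c\<in>\<kappa> ` A. ?x c)\<^sup>2) \<le> real ((\<Sum>c\<in>\<kappa> ` A. (?x c)\<^sup>2) * card (\<kappa> ` A))"
      by simp
    hence "(\<Sum>c\<in>\<kappa> ` A. ?x c)\<^sup>2 \<le> (\<Sum>c\<in>\<kappa> ` A. (?x c)\<^sup>2) * card (\<kappa> ` A)"
      by (simp only: of_nat_le_iff)
    also have "\<dots> \<le> (\<Sum>c\<in>\<kappa> ` A. (?x c)\<^sup>2) * n" using n by (rule mult_le_mono2)
    finally show ?thesis by (simp add: mult.commute)
  qed
  also have "(\<Sum>c\<in>\<kappa> ` A. (?x c)\<^sup>2) = card (\<Union>c\<in>\<kappa> ` A. ?fib c \<times> ?fib c)"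
    using A by (subst card_UN_disjoint) (auto simp: card_cartesian_product power2_eq_square)
  also have "(\<Union>c\<in>\<kappa> ` A. ?fib c \<times> ?fib c) = {(a, b). a \<in> A \<and> b \<in> A \<and> \<kappa> a = \<kappa> b}"
    by auto
  finally show ?thesis .
qed


text \<open>However one of \<open>u i\<close> and \<open>v i\<close> is chosen at each index \<open>i\<close>, the combined map takes at most
\<open>\<Prod>i\<in>I. n i\<close> values, so the Cauchy-Schwarz bound applies to each of the \<open>2 ^ card I\<close> choices. The
summand on the right is the number of choices under which \<open>a\<close> and \<open>b\<close> collide: only indices at which
both maps agree leave any freedom.\<close>

lemma collisions_all_choices:
  fixes u v :: "'i \<Rightarrow> 'a \<Rightarrow> 'c" and n :: "'i \<Rightarrow> nat"
  assumes A: "finite A" and I: "finite I"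
    and u: "\<And>i. i \<in> I \<Longrightarrow> card (u i ` A) \<le> n i" and v: "\<And>i. i \<in> I \<Longrightarrow> card (v i ` A) \<le> n i"
  shows "2 ^ card I * (card A)\<^sup>2 \<le> (\<Prod>i\<in>I. n i) *
    (\<Sum>(a, b)\<in>A \<times> A. if \<forall>i\<in>I. u i a = u i b \<or> v i a = v i b
        then 2 ^ card {i \<in> I. u i a = u i b \<and> v i a = v i b} else 0)"
proof -
  define same where "same T a b \<longleftrightarrow> (\<forall>i\<in>I. if i \<in> T then u i a = u i b else v i a = v i b)" for T a b
  define \<kappa> where "\<kappa> T a = (\<lambda>i\<in>I. if i \<in> T then u i a else v i a)" for T a
  have \<kappa>: "\<kappa> T a = \<kappa> T b \<longleftrightarrow> same T a b" for T a b
    by (auto simp: \<kappa>_def same_def fun_eq_iff restrict_def)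
  have "2 ^ card I * (card A)\<^sup>2 = (\<Sum>T\<in>Pow I. (card A)\<^sup>2)"
    using I by (simp add: card_Pow)
  also have "\<dots> \<le> (\<Sum>T\<in>Pow I. (\<Prod>i\<in>I. n i) * card {(a, b). a \<in> A \<and> b \<in> A \<and> same T a b})"
  proof (intro sum_mono)
    fix T
    have "card (\<kappa> T ` A) \<le> card (Pi\<^sub>E I (\<lambda>i. if i \<in> T then u i ` A else v i ` A))"
      using A I by (intro card_mono finite_PiE) (auto simp: \<kappa>_def)
    also have "\<dots> = (\<Prod>i\<in>I. card (if i \<in> T then u i ` A else v i ` A))"
      using I by (simp add: card_PiE)
    also have "\<dots> \<le> (\<Prod>i\<in>I. n i)" using u v by (intro prod_mono) auto
    finally show "(card A)\<^sup>2 \<le> (\<Prod>i\<in>I. n i) * card {(a, b). a \<in> A \<and> b \<in> A \<and> same T a b}"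
      using card_sq_le_collisions[OF A] unfolding \<kappa>[symmetric] by blast
  qed
  also have "\<dots> = (\<Prod>i\<in>I. n i) * (\<Sum>T\<in>Pow I. \<Sum>(a, b)\<in>A \<times> A. if same T a b then 1 else 0)"
  proof -
    have "card {(a, b). a \<in> A \<and> b \<in> A \<and> same T a b}
        = (\<Sum>(a, b)\<in>A \<times> A. if same T a b then 1 else 0)" for T
    proof -
      have "{(a, b). a \<in> A \<and> b \<in> A \<and> same T a b} = {z \<in> A \<times> A. case z of (a, b) \<Rightarrow> same T a b}"
        by auto
      then show ?thesis
        using A by (simp add: split_def sum.If_cases Int_def)
    qed
    then show ?thesis by (simp only: sum_distrib_left)
  qed
  also have "(\<Sum>T\<in>Pow I. \<Sum>(a, b)\<in>A \<times> A. if same T a b then 1 else 0)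
      = (\<Sum>(a, b)\<in>A \<times> A. \<Sum>T\<in>Pow I. if same T a b then (1::nat) else 0)"
    by (subst sum.swap) (simp add: split_def)
  also have "\<dots> = (\<Sum>(a, b)\<in>A \<times> A. card {T \<in> Pow I. same T a b})"
    using I by (simp add: split_def sum.If_cases Int_def)
  also have "(\<Prod>i\<in>I. n i) * \<dots> \<le> (\<Prod>i\<in>I. n i) * (\<Sum>(a, b)\<in>A \<times> A. if \<forall>i\<in>I. u i a = u i b \<or> v i a = v i b
        then 2 ^ card {i \<in> I. u i a = u i b \<and> v i a = v i b} else 0)"
  proof (intro mult_le_mono2 sum_mono, clarify)
    fix a b
    let ?both = "{i \<in> I. u i a = u i b \<and> v i a = v i b}"
    show "card {T \<in> Pow I. same T a b} \<le> (if \<forall>i\<in>I. u i a = u i b \<or> v i a = v i b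
        then 2 ^ card ?both else 0)"
    proof (cases "\<forall>i\<in>I. u i a = u i b \<or> v i a = v i b")
      case True
      \<comment> \<open>An admissible choice is determined by its restriction to the indices where both maps agree.\<close>
      have "inj_on (\<lambda>T. T \<inter> ?both) {T \<in> Pow I. same T a b}"
      proof (rule inj_onI)
        fix T U assume T: "T \<in> {T \<in> Pow I. same T a b}" and U: "U \<in> {T \<in> Pow I. same T a b}"
          and eq: "T \<inter> ?both = U \<inter> ?both"
        have "i \<in> T \<longleftrightarrow> i \<in> U" if i: "i \<in> I" for i
        proof (cases "i \<in> ?both")
          case True
          then show ?thesis using eq by blast
        next
          case False
          with i T U show ?thesis unfolding same_def by (auto split: if_splits)
        qed
        then show "T = U" using T U by blast
      qed
      moreover have "(\<lambda>T. T \<inter> ?both) ` {T \<in> Pow I. same T a b} \<subseteq> Pow ?both" by auto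
      ultimately have "card {T \<in> Pow I. same T a b} \<le> card (Pow ?both)"
        using I by (intro card_inj_on_le) auto
      then show ?thesis using True I by (simp add: card_Pow)
    next
      case False
      then have "\<not> same T a b" for T unfolding same_def by metis
      then show ?thesis by simp
    qed
  qed
  finally show ?thesis .
qed

lemma prod_primes_dvd:
  fixes T :: "nat set"
  assumes "finite T" "\<And>p. p \<in> T \<Longrightarrow> prime p" "\<And>p. p \<in> T \<Longrightarrow> p ^ e dvd m"
  shows "(\<Prod>p\<in>T. p ^ e) dvd m"
  using assms
proof (induction T rule: finite_induct)
  case (insert p T)
  have "coprime p q" if "q \<in> T" for q
    using insert.prems(1)[of p] insert.prems(1)[of q] insert.hyps(2) that
    by (intro primes_coprime) auto
  then have "coprime (p ^ e) (\<Prod>q\<in>T. q ^ e)"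
    by (intro prod_coprime_right) auto
  moreover have "(\<Prod>q\<in>T. q ^ e) dvd m" "p ^ e dvd m" using insert by auto
  ultimately show ?case using insert.hyps by (simp add: divides_mult)
qed auto

text \<open>Expanding \<open>2 ^ card S\<close> as the number of subsets of \<open>S\<close> and exchanging the sums
bounds the left-hand side by \<open>X * (\<Prod>p\<in>P. 1 + 1 / p)\<close>. Each factor is at most \<open>3/2\<close>; this is all the saving
needed, because the trivial bound has \<open>2\<close> in place of \<open>3/2\<close>.\<close>

lemma sum_two_power_prime_divisors_le:
  fixes P :: "nat set" and X :: nat
  assumes P: "finite P" "\<And>p. p \<in> P \<Longrightarrow> prime p"
  shows "(\<Sum>m = 1..X. 2 ^ card {p \<in> P. p dvd m} :: real) \<le> X * (3/2) ^ card P"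
proof -
  have "(\<Sum>m = 1..X. 2 ^ card {p \<in> P. p dvd m} :: real)
      = (\<Sum>m = 1..X. \<Sum>T\<in>Pow P. if \<forall>p\<in>T. p dvd m then 1 else 0)"
  proof (intro sum.cong refl)
    fix m
    have "{T \<in> Pow P. \<forall>p\<in>T. p dvd m} = Pow {p \<in> P. p dvd m}" by auto
    then have "(\<Sum>T\<in>Pow P. if \<forall>p\<in>T. p dvd m then 1 else (0::real)) = card (Pow {p \<in> P. p dvd m})"
      using P by (simp add: sum.If_cases Int_def)
    then show "2 ^ card {p \<in> P. p dvd m} = (\<Sum>T\<in>Pow P. if \<forall>p\<in>T. p dvd m then 1 else (0::real))"
      using P by (simp add: card_Pow)
  qed
  also have "\<dots> = (\<Sum>T\<in>Pow P. \<Sum>m = 1..X. if \<forall>p\<in>T. p dvd m then 1 else 0)"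
    by (rule sum.swap)
  also have "\<dots> \<le> (\<Sum>T\<in>Pow P. X * (\<Prod>p\<in>T. 1 / real p))"
  proof (intro sum_mono)
    fix T assume T: "T \<in> Pow P"
    then have finT: "finite T" using P finite_subset by auto
    let ?d = "\<Prod>p\<in>T. p"
    have d: "?d > 0" using T P by (intro prod_pos) (auto simp: prime_gt_0_nat)
    have "(\<Sum>m = 1..X. if \<forall>p\<in>T. p dvd m then 1 else (0::real)) = card {m \<in> {1..X}. \<forall>p\<in>T. p dvd m}"
      by (simp add: sum.If_cases Int_def)
    also have "card {m \<in> {1..X}. \<forall>p\<in>T. p dvd m} \<le> card ((\<lambda>j. ?d * j) ` {1..X div ?d})"
    proof (intro card_mono)
      show "{m \<in> {1..X}. \<forall>p\<in>T. p dvd m} \<subseteq> (\<lambda>j. ?d * j) ` {1..X div ?d}"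
      proof
        fix m assume m: "m \<in> {m \<in> {1..X}. \<forall>p\<in>T. p dvd m}"
        then have "?d dvd m" using prod_primes_dvd[of T 1 m] finT T P by auto
        then obtain j where j: "m = ?d * j" by auto
        with m have "1 \<le> j" by (cases j) auto
        moreover have "j \<le> X div ?d"
          using m j d by (simp add: less_eq_div_iff_mult_less_eq mult.commute)
        ultimately show "m \<in> (\<lambda>j. ?d * j) ` {1..X div ?d}" using j by auto
      qed
    qed auto
    also have "\<dots> \<le> X div ?d" using card_image_le[of "{1..X div ?d}"] by fastforce
    finally have "(\<Sum>m = 1..X. if \<forall>p\<in>T. p dvd m then 1 else (0::real)) \<le> real (X div ?d)" by simp
    also have "\<dots> \<le> real X / real ?d" by (rule of_nat_div_le_of_nat)
    also have "\<dots> = X * (\<Prod>p\<in>T. 1 / real p)" by (simp add: prod_dividef)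
    finally show "(\<Sum>m = 1..X. if \<forall>p\<in>T. p dvd m then 1 else 0) \<le> X * (\<Prod>p\<in>T. 1 / real p)" .
  qed
  also have "\<dots> = X * (\<Prod>p\<in>P. 1 / real p + 1)"
    using prod_add[OF P(1), of "\<lambda>p. 1 / real p" "\<lambda>_. 1"] by (simp add: sum_distrib_left)
  also have "\<dots> \<le> X * (\<Prod>p\<in>P. 3 / 2)"
  proof (intro mult_left_mono prod_mono conjI)
    fix p assume "p \<in> P"
    then have "real p \<ge> 2" using P(2)[of p] prime_ge_2_nat[of p] by simp
    then show "1 / real p + 1 \<le> 3 / 2" by (simp add: field_simps)
  qed auto
  finally show ?thesis by simp
qed

lemma sum_symmetric_interval:
  fixes g :: "nat \<Rightarrow> real"
  shows "(\<Sum>q\<in>{-int X..int X}. g (nat \<bar>q\<bar>)) = g 0 + 2 * (\<Sum>m = 1..X. g m)"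
proof (induction X)
  case (Suc X)
  have "{-int (Suc X)..int (Suc X)} = insert (int (Suc X)) (insert (-int (Suc X)) {-int X..int X})"
    by auto
  then show ?case using Suc by (simp add: algebra_simps nat_add_distrib)
qed simp

lemma sum_progression_le:
  fixes P :: "nat set" and X Q :: nat
  assumes P: "finite P" "\<And>p. p \<in> P \<Longrightarrow> prime p" and Q: "Q > 0"
  shows "(\<Sum>m = 1..X. if Q dvd m then 2 ^ card {p \<in> P. p dvd m div Q} else (0::real))
      \<le> X / Q * (3/2) ^ card P"
proof -
  have "(\<Sum>m = 1..X. if Q dvd m then 2 ^ card {p \<in> P. p dvd m div Q} else (0::real))
      = (\<Sum>m\<in>{m \<in> {1..X}. Q dvd m}. 2 ^ card {p \<in> P. p dvd m div Q})"
    by (simp add: sum.If_cases Int_def)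
  also have "\<dots> = (\<Sum>j = 1..X div Q. 2 ^ card {p \<in> P. p dvd j})"
  proof (rule sum.reindex_bij_witness[of _ "\<lambda>j. Q * j" "\<lambda>m. m div Q"])
    fix m assume "m \<in> {m \<in> {1..X}. Q dvd m}"
    then show "m div Q \<in> {1..X div Q}"
      using Q by (auto simp: div_le_mono dvd_imp_le div_greater_zero_iff Suc_le_eq)
  next
    fix j assume "j \<in> {1..X div Q}"
    then show "Q * j \<in> {m \<in> {1..X}. Q dvd m}"
      using Q by (auto simp: less_eq_div_iff_mult_less_eq mult.commute)
  qed (use Q in auto)
  also have "\<dots> \<le> (X div Q) * (3/2) ^ card P"
    by (rule sum_two_power_prime_divisors_le[OF P])
  also have "\<dots> \<le> X / Q * (3/2) ^ card P"
    by (intro mult_right_mono of_nat_div_le_of_nat) auto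
  finally show ?thesis .
qed

text \<open>The two lattices at \<open>p\<close> are the kernel of \<open>L p\<close> modulo \<open>p ^ r\<close> and the multiples of
\<open>p\<close>. Pairs congruent modulo the chosen lattices have \<open>Q dvd \<Phi>\<close>, and by \<open>L12\<close> the primes at
which both congruences hold divide \<open>\<Phi> div Q\<close>. The three terms come from the diagonal, from the value \<open>0\<close>, and from
the other values.\<close>

lemma card_le_two_lattices:
  fixes \<Phi> :: "(nat \<Rightarrow> int) \<Rightarrow> int" and P :: "nat set" and L :: "nat \<Rightarrow> (nat \<Rightarrow> int) \<Rightarrow> int"
  assumes A: "finite A" and P: "finite P" "\<And>p. p \<in> P \<Longrightarrow> prime p"
    and add: "\<And>p a b. L p (\<lambda>i. a i - b i) = L p a - L p b"
    and L1: "\<And>p d. p \<in> P \<Longrightarrow> int p ^ r dvd L p d \<Longrightarrow> int p ^ r dvd \<Phi> d"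
    and L2: "\<And>p d. p \<in> P \<Longrightarrow> \<forall>i\<in>{1..r}. int p dvd d i \<Longrightarrow> int p ^ r dvd \<Phi> d"
    and L12: "\<And>p d. p \<in> P \<Longrightarrow> int p ^ r dvd L p d \<Longrightarrow> \<forall>i\<in>{1..r}. int p dvd d i \<Longrightarrow>
                int p ^ Suc r dvd \<Phi> d"
    and X: "\<And>a b. a \<in> A \<Longrightarrow> b \<in> A \<Longrightarrow> \<bar>\<Phi> (\<lambda>i. a i - b i)\<bar> \<le> int X"
    and B: "\<And>q. real (card {(a, b). a \<in> A \<and> b \<in> A \<and> a \<noteq> b \<and> \<Phi> (\<lambda>i. a i - b i) = q}) \<le> B"
  defines "Q \<equiv> \<Prod>p\<in>P. p ^ r"
  shows "(real (card A))\<^sup>2 \<le> real Q * real (card A) + B * real Q + 2 * B * real X * (3/4) ^ card P"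
proof -
  let ?k = "card P"
  have B0: "B \<ge> 0" using B[of 0] by linarith
  have Q: "Q > 0" unfolding Q_def using P by (intro prod_pos) (auto simp: prime_gt_0_nat)
  \<comment> \<open>The residue of \<open>L p a\<close> is stored as a function on a singleton so that \<open>u\<close> and \<open>v\<close> have the same type.\<close>
  define u where "u p a = (\<lambda>i\<in>{0::nat}. L p a mod int p ^ r)" for p and a :: "nat \<Rightarrow> int"
  define v where "v p a = (\<lambda>i\<in>{1..r}. a i mod int p)" for p and a :: "nat \<Rightarrow> int"
  define w where "w a b = (if \<forall>p\<in>P. u p a = u p b \<or> v p a = v p b
        then 2 ^ card {p \<in> P. u p a = u p b \<and> v p a = v p b} else (0::nat))" for a b
  have u_iff: "u p a = u p b \<longleftrightarrow> int p ^ r dvd L p (\<lambda>i. a i - b i)" for p a b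
    by (simp add: u_def add fun_eq_iff restrict_def mod_eq_dvd_iff)
  have v_iff: "v p a = v p b \<longleftrightarrow> (\<forall>i\<in>{1..r}. int p dvd a i - b i)" for p a b
    by (auto simp: v_def fun_eq_iff restrict_def mod_eq_dvd_iff)
  have card_u: "card (u p ` A) \<le> p ^ r" if p: "p \<in> P" for p
  proof -
    have "card (u p ` A) \<le> card (PiE {0::nat} (\<lambda>_. {0..<int p ^ r}))"
      using P(2)[OF p] by (intro card_mono finite_PiE) (auto simp: u_def prime_gt_0_nat split: if_splits)
    also have "\<dots> = p ^ r" by (simp add: card_PiE nat_power_eq)
    finally show ?thesis .
  qed
  have card_v: "card (v p ` A) \<le> p ^ r" if p: "p \<in> P" for p
  proof -
    have "card (v p ` A) \<le> card (PiE {1..r} (\<lambda>_. {0..<int p}))"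
      using P(2)[OF p] by (intro card_mono finite_PiE) (auto simp: v_def prime_gt_0_nat)
    also have "\<dots> = p ^ r" by (simp add: card_PiE)
    finally show ?thesis .
  qed
  define W :: "nat \<Rightarrow> real" where
    "W m = (if Q dvd m then 2 ^ card {p \<in> P. p dvd m div Q} else 0)" for m
  have w_le: "real (w a b) \<le> W (nat \<bar>\<Phi> (\<lambda>i. a i - b i)\<bar>)" for a b
  proof (cases "\<forall>p\<in>P. u p a = u p b \<or> v p a = v p b")
    case True
    let ?q = "\<Phi> (\<lambda>i. a i - b i)"
    have dvd_nat: "p ^ e dvd nat \<bar>?q\<bar>" if "int p ^ e dvd ?q" for p e
      using that by (simp add: int_dvd_int_iff[symmetric])
    have "p ^ r dvd nat \<bar>?q\<bar>" if "p \<in> P" for p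
      using True L1[OF that] L2[OF that] that by (intro dvd_nat) (auto simp: u_iff v_iff)
    then have Qd: "Q dvd nat \<bar>?q\<bar>" unfolding Q_def using P by (intro prod_primes_dvd) auto
    then obtain m where m: "nat \<bar>?q\<bar> = Q * m" by (elim dvdE)
    have "p dvd m" if p: "p \<in> P" "u p a = u p b" "v p a = v p b" for p
    proof -
      have "p ^ Suc r dvd nat \<bar>?q\<bar>"
        using L12[OF p(1)] p by (intro dvd_nat) (auto simp: u_iff v_iff)
      moreover have "Q = p ^ r * (\<Prod>q\<in>P - {p}. q ^ r)"
        unfolding Q_def using P p by (simp add: prod.remove)
      ultimately have "p ^ r * p dvd p ^ r * ((\<Prod>q\<in>P - {p}. q ^ r) * m)"
        using m by (simp add: mult.assoc mult.commute)
      then have "p dvd (\<Prod>q\<in>P - {p}. q ^ r) * m"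
        using P(2)[OF p(1)] by (simp add: prime_gt_0_nat)
      moreover have "coprime p (\<Prod>q\<in>P - {p}. q ^ r)"
      proof (intro prod_coprime_right)
        fix q assume q: "q \<in> P - {p}"
        then have "coprime p q" using P(2)[OF p(1)] P(2)[of q] by (intro primes_coprime) auto
        then show "coprime p (q ^ r)" by simp
      qed
      ultimately show ?thesis using coprime_dvd_mult_right_iff by blast
    qed
    then have "{p \<in> P. u p a = u p b \<and> v p a = v p b} \<subseteq> {p \<in> P. p dvd m}" by blast
    then have "card {p \<in> P. u p a = u p b \<and> v p a = v p b} \<le> card {p \<in> P. p dvd m}"
      using P by (intro card_mono) auto
    then have "(2::real) ^ card {p \<in> P. u p a = u p b \<and> v p a = v p b} \<le> 2 ^ card {p \<in> P. p dvd m}"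
      by (intro power_increasing) auto
    moreover have "real (w a b) = 2 ^ card {p \<in> P. u p a = u p b \<and> v p a = v p b}"
      using True unfolding w_def by simp
    moreover have "W (nat \<bar>?q\<bar>) = 2 ^ card {p \<in> P. p dvd m}"
      unfolding W_def m using Q by simp
    ultimately show ?thesis by linarith
  next
    case False
    then show ?thesis unfolding w_def W_def by auto
  qed
  have "2 ^ ?k * (card A)\<^sup>2 \<le> Q * (\<Sum>(a, b)\<in>A \<times> A. w a b)"
    unfolding Q_def w_def by (rule collisions_all_choices[OF A P(1) card_u card_v])
  then have "real (2 ^ ?k * (card A)\<^sup>2) \<le> real (Q * (\<Sum>(a, b)\<in>A \<times> A. w a b))"
    by (simp only: of_nat_le_iff)
  then have main: "2 ^ ?k * (real (card A))\<^sup>2 \<le> Q * (\<Sum>z\<in>A \<times> A. real (w (fst z) (snd z)))"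
    by (simp add: split_def)
  define D where "D = (\<lambda>a. (a, a)) ` A"
  define O' where "O' = {z \<in> A \<times> A. fst z \<noteq> snd z}"
  have AA: "A \<times> A = D \<union> O'" "D \<inter> O' = {}" "finite D" "finite O'"
    using A by (auto simp: D_def O'_def)
  have diag: "(\<Sum>z\<in>D. real (w (fst z) (snd z))) = 2 ^ ?k * card A"
    unfolding D_def by (subst sum.reindex) (auto simp: inj_on_def w_def)
  define f where "f z = \<Phi> (\<lambda>i. fst z i - snd z i)" for z :: "(nat \<Rightarrow> int) \<times> (nat \<Rightarrow> int)"
  have "(\<Sum>z\<in>O'. real (w (fst z) (snd z))) \<le> (\<Sum>z\<in>O'. W (nat \<bar>f z\<bar>))"
    unfolding f_def by (intro sum_mono w_le)
  also have "\<dots> = (\<Sum>q\<in>{-int X..int X}. \<Sum>z\<in>{z \<in> O'. f z = q}. W (nat \<bar>f z\<bar>))"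
  proof (rule sum.group[symmetric])
    show "f ` O' \<subseteq> {- int X..int X}"
    proof
      fix q assume "q \<in> f ` O'"
      then obtain a b where "a \<in> A" "b \<in> A" "q = \<Phi> (\<lambda>i. a i - b i)"
        by (auto simp: f_def O'_def)
      then show "q \<in> {- int X..int X}" using X[of a b] by auto
    qed
  qed (use AA in auto)
  also have "\<dots> = (\<Sum>q\<in>{-int X..int X}. card {z \<in> O'. f z = q} * W (nat \<bar>q\<bar>))"
    by simp
  also have "\<dots> \<le> (\<Sum>q\<in>{-int X..int X}. B * W (nat \<bar>q\<bar>))"
  proof (intro sum_mono mult_right_mono)
    fix q
    have "{z \<in> O'. f z = q} = {(a, b). a \<in> A \<and> b \<in> A \<and> a \<noteq> b \<and> \<Phi> (\<lambda>i. a i - b i) = q}"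
      by (auto simp: O'_def f_def)
    then show "real (card {z \<in> O'. f z = q}) \<le> B" using B[of q] by simp
  qed (auto simp: W_def)
  also have "\<dots> = B * (\<Sum>q\<in>{-int X..int X}. W (nat \<bar>q\<bar>))" by (simp add: sum_distrib_left)
  also have "(\<Sum>q\<in>{-int X..int X}. W (nat \<bar>q\<bar>)) = W 0 + 2 * (\<Sum>m = 1..X. W m)"
    by (rule sum_symmetric_interval)
  also have "W 0 = 2 ^ ?k" unfolding W_def by simp
  also have "(\<Sum>m = 1..X. W m) \<le> X / Q * (3/2) ^ ?k"
    unfolding W_def by (rule sum_progression_le[OF P Q])
  finally have off: "(\<Sum>z\<in>O'. real (w (fst z) (snd z))) \<le> B * (2 ^ ?k + 2 * (X / Q * (3/2) ^ ?k))"
    using B0 by (simp add: mult_left_mono)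
  have "(\<Sum>z\<in>A \<times> A. real (w (fst z) (snd z)))
      = (\<Sum>z\<in>D. real (w (fst z) (snd z))) + (\<Sum>z\<in>O'. real (w (fst z) (snd z)))"
    unfolding AA(1) by (rule sum.union_disjoint) (use AA in auto)
  then have "(\<Sum>z\<in>A \<times> A. real (w (fst z) (snd z)))
      \<le> 2 ^ ?k * card A + B * (2 ^ ?k + 2 * (X / Q * (3/2) ^ ?k))"
    using diag off by simp
  then have "2 ^ ?k * (real (card A))\<^sup>2
      \<le> Q * (2 ^ ?k * card A + B * (2 ^ ?k + 2 * (X / Q * (3/2) ^ ?k)))"
    using main mult_left_mono[of _ _ "real Q"] by (meson of_nat_0_le_iff order_trans)
  also have "\<dots> = 2 ^ ?k * (Q * card A + B * Q + 2 * B * X * (3/4) ^ ?k)"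
  proof -
    have "(3/2::real) ^ ?k = 2 ^ ?k * (3/4) ^ ?k" by (simp add: power_mult_distrib[symmetric])
    then show ?thesis using Q by (simp add: field_simps)
  qed
  finally show ?thesis by simp
qed

section \<open>Prime powers dividing polynomial values\<close>

text \<open>This much of Taylor's formula serves both halves of Hensel's lemma: existence of a lift
and its uniqueness.\<close>

lemma poly_taylor_second_order:
  fixes f :: "'a::idom poly"
  shows "\<exists>t. poly f (a + h) = poly f a + h * poly (pderiv f) a + h\<^sup>2 * t"
proof (induction f)
  case (pCons c g)
  then obtain t where t: "poly g (a + h) = poly g a + h * poly (pderiv g) a + h\<^sup>2 * t" by blast
  have "poly (pCons c g) (a + h) = poly (pCons c g) a + h * poly (pderiv (pCons c g)) a
          + h\<^sup>2 * (poly (pderiv g) a + (a + h) * t)"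
    by (simp add: t pderiv_pCons algebra_simps power2_eq_square)
  then show ?case by blast
qed (intro exI[of _ 0], simp)

lemma poly_diff_dvd: "(a - b :: 'a::idom) dvd poly f a - poly f b"
proof -
  obtain t where "poly f (b + (a - b)) = poly f b + (a - b) * poly (pderiv f) b + (a - b)\<^sup>2 * t"
    using poly_taylor_second_order by blast
  then have "poly f a - poly f b = (a - b) * (poly (pderiv f) b + (a - b) * t)"
    by (simp add: algebra_simps power2_eq_square)
  then show ?thesis by simp
qed

text \<open>Newton iteration, correcting \<open>b\<close> by a multiple of \<open>p ^ Suc k\<close> in each step.\<close>

lemma hensel_lift:
  fixes f :: "int poly" and p :: int
  assumes p: "prime p" and root: "p dvd poly f a" and simple: "\<not> p dvd poly (pderiv f) a"
  shows "\<exists>b. p ^ Suc k dvd poly f b \<and> p dvd b - a"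
proof (induction k)
  case 0
  show ?case using root by (intro exI[of _ a]) simp
next
  case (Suc k)
  then obtain b where b: "p ^ Suc k dvd poly f b" "p dvd b - a" by blast
  have "p dvd poly (pderiv f) b - poly (pderiv f) a"
    using b(2) poly_diff_dvd dvd_trans by blast
  then have "\<not> p dvd poly (pderiv f) b" using simple by (metis diff_add_cancel dvd_add_right_iff)
  then have "coprime (poly (pderiv f) b) p"
    using p by (simp add: prime_imp_coprime coprime_commute)
  then obtain s z where "s * poly (pderiv f) b + z * p = 1"
    using bezout_int[of "poly (pderiv f) b" p] by (auto simp: coprime_iff_gcd_eq_1)
  then have z: "1 - poly (pderiv f) b * s = p * z" by (simp add: algebra_simps)
  obtain e where e: "poly f b = p ^ Suc k * e" using b(1) by (elim dvdE)
  define h where "h = - (p ^ Suc k * e * s)"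
  obtain t where "poly f (b + h) = poly f b + h * poly (pderiv f) b + h\<^sup>2 * t"
    using poly_taylor_second_order by blast
  also have "\<dots> = p ^ Suc k * e * (1 - poly (pderiv f) b * s) + p ^ Suc k * p ^ Suc k * ((e * s)\<^sup>2 * t)"
    by (simp add: e h_def algebra_simps power2_eq_square)
  also have "\<dots> = p ^ Suc (Suc k) * (e * z + p ^ k * ((e * s)\<^sup>2 * t))"
    unfolding z by (simp add: algebra_simps)
  finally have "p ^ Suc (Suc k) dvd poly f (b + h)" by simp
  moreover have "p dvd (b + h) - a"
  proof -
    have "(b + h) - a = (b - a) + p * (- (p ^ k * e * s))" by (simp add: h_def)
    then show ?thesis using b(2) by (metis dvd_add dvd_triv_left)
  qed
  ultimately show ?case by blast
qed

lemma simple_roots_unique: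
  fixes f :: "int poly" and p :: int
  assumes p: "prime p" and "p ^ j dvd poly f a" "p ^ j dvd poly f b"
    and ab: "p dvd b - a" and simple: "\<not> p dvd poly (pderiv f) a"
  shows "p ^ j dvd b - a"
proof -
  obtain t where "poly f (a + (b - a)) = poly f a + (b - a) * poly (pderiv f) a + (b - a)\<^sup>2 * t"
    using poly_taylor_second_order by blast
  then have "poly f b - poly f a = (b - a) * (poly (pderiv f) a + (b - a) * t)"
    by (simp add: algebra_simps power2_eq_square)
  moreover have "p ^ j dvd poly f b - poly f a" using assms by (intro dvd_diff)
  ultimately have "p ^ j dvd (b - a) * (poly (pderiv f) a + (b - a) * t)" by simp
  moreover have "\<not> p dvd poly (pderiv f) a + (b - a) * t"
    using simple ab by (simp add: dvd_add_left_iff)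
  then have "coprime (p ^ j) (poly (pderiv f) a + (b - a) * t)"
    using p by (simp add: prime_imp_coprime)
  ultimately show ?thesis using coprime_dvd_mult_left_iff by blast
qed

lemma card_roots_mod_prime_le:
  fixes f :: "int poly" and p :: int
  assumes p: "prime p" and lc: "\<not> p dvd lead_coeff f"
    and S: "finite S" "\<And>x. x \<in> S \<Longrightarrow> p dvd poly f x" "\<And>x y. x \<in> S \<Longrightarrow> y \<in> S \<Longrightarrow> p dvd x - y \<Longrightarrow> x = y"
  shows "card S \<le> degree f"
  using lc S
proof (induction "degree f" arbitrary: f S)
  case 0
  then have "poly f x = lead_coeff f" for x
    by (metis degree_eq_zeroE poly_const_conv coeff_pCons_0)
  then have "S = {}" using 0 by auto
  then show ?case by simp
next
  case (Suc n)
  show ?case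
  proof (cases "S = {}")
    case False
    then obtain a where a: "a \<in> S" by blast
    define g where "g = synthetic_div f a"
    have fg: "poly f x - poly f a = (x - a) * poly g x" for x
    proof -
      have "poly (f + smult a g) x = poly (pCons (poly f a) g) x"
        using synthetic_div_correct[of f a] by (simp add: g_def)
      then show ?thesis by (simp add: algebra_simps)
    qed
    have deg: "degree g = n" using Suc(2) by (simp add: g_def degree_synthetic_div)
    have "lead_coeff g = lead_coeff f"
    proof -
      have "coeff (f + smult a g) (Suc n) = coeff (pCons (poly f a) g) (Suc n)"
        using synthetic_div_correct[of f a] by (simp add: g_def)
      moreover have "coeff g (Suc n) = 0" using deg by (simp add: coeff_eq_0)
      ultimately show ?thesis using deg Suc(2)[symmetric] by simp
    qed
    then have "card (S - {a}) \<le> degree g"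
    proof (intro Suc(1))
      fix x assume x: "x \<in> S - {a}"
      have "p dvd (x - a) * poly g x" unfolding fg[symmetric] using x a Suc by (intro dvd_diff) auto
      then show "p dvd poly g x" using x a Suc(6)[of x a] p prime_dvd_mult_iff by blast
    qed (use Suc deg in auto)
    then show ?thesis using a Suc(4) deg Suc(2) by simp
  qed simp
qed

lemma card_residue_class_le:
  assumes T: "T \<subseteq> {1..X}" and cong: "\<And>s t. s \<in> T \<Longrightarrow> t \<in> T \<Longrightarrow> int m dvd int s - int t"
  shows "card T \<le> X div m + 1"
proof -
  have "inj_on (\<lambda>t. t div m) T"
  proof (rule inj_onI)
    fix s t assume st: "s \<in> T" "t \<in> T" "s div m = t div m"
    have "s mod m = t mod m"
      using cong[OF st(1,2)] by (metis mod_eq_dvd_iff of_nat_eq_iff zmod_int)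
    then show "s = t" using st(3) by (metis div_mult_mod_eq)
  qed
  moreover have "(\<lambda>t. t div m) ` T \<subseteq> {0..X div m}" using T by (auto simp: div_le_mono)
  ultimately have "card T \<le> card {0..X div m}" by (intro card_inj_on_le) auto
  then show ?thesis by simp
qed

text \<open>There are at most \<open>degree f\<close> roots modulo \<open>p\<close>. They are simple, so each is the
reduction of at most one residue class of roots modulo \<open>p ^ j\<close>, and \<open>degree f\<close> bounds the number of these
classes for every \<open>j\<close>.\<close>

lemma card_prime_power_dvd_values_le:
  fixes f :: "int poly" and a w :: int and p X j :: nat
  assumes p: "prime p" and lc: "\<not> int p dvd lead_coeff f" and w: "\<not> int p dvd w"
    and simple: "\<And>x. int p dvd poly f x \<Longrightarrow> \<not> int p dvd poly (pderiv f) x" and j: "j \<ge> 1"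
  shows "card {t \<in> {1..X}. int p ^ j dvd poly f (a + w * int t)} \<le> degree f * (X div p ^ j + 1)"
proof -
  define T where "T = {t \<in> {1..X}. int p ^ j dvd poly f (a + w * int t)}"
  define \<rho> where "\<rho> t = (a + w * int t) mod int p" for t
  have pp: "prime (int p)" using p by simp
  have dvdp: "int p dvd poly f (a + w * int t)" if "t \<in> T" for t
  proof -
    have "int p dvd int p ^ j" using j by (intro dvd_power) simp
    also have "\<dots> dvd poly f (a + w * int t)" using that by (simp add: T_def)
    finally show ?thesis .
  qed
  have "card (\<rho> ` T) \<le> degree f"
  proof (rule card_roots_mod_prime_le[OF pp lc])
    show "finite (\<rho> ` T)" unfolding T_def by simp
    show "int p dvd poly f x" if x: "x \<in> \<rho> ` T" for x
    proof -
      obtain t where t: "t \<in> T" "x = \<rho> t" using x by blast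
      have "int p dvd (a + w * int t) - x" unfolding t \<rho>_def by (simp add: minus_mod_eq_mult_div)
      then have "int p dvd poly f (a + w * int t) - poly f x" using poly_diff_dvd dvd_trans by blast
      from dvd_diff[OF dvdp[OF t(1)] this] show ?thesis by simp
    qed
    show "x = y" if "x \<in> \<rho> ` T" "y \<in> \<rho> ` T" "int p dvd x - y" for x y
      using that by (auto simp: \<rho>_def mod_eq_dvd_iff[symmetric])
  qed
  moreover have "card {t \<in> T. \<rho> t = c} \<le> X div p ^ j + 1" for c
  proof (rule card_residue_class_le)
    show "{t \<in> T. \<rho> t = c} \<subseteq> {1..X}" unfolding T_def by blast
    fix s t assume st: "s \<in> {t \<in> T. \<rho> t = c}" "t \<in> {t \<in> T. \<rho> t = c}"
    then have "int p dvd (a + w * int s) - (a + w * int t)"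
      unfolding \<rho>_def mod_eq_dvd_iff[symmetric] by simp
    moreover have "int p ^ j dvd poly f (a + w * int t)" "int p ^ j dvd poly f (a + w * int s)"
      and "t \<in> T" using st by (auto simp: T_def)
    ultimately have "int p ^ j dvd (a + w * int s) - (a + w * int t)"
      using simple_roots_unique[OF pp] simple[OF dvdp[of t]] by blast
    then have "int p ^ j dvd w * (int s - int t)" by (simp add: algebra_simps)
    moreover have "coprime (int p ^ j) w" using w pp by (simp add: prime_imp_coprime)
    ultimately show "int (p ^ j) dvd int s - int t" by (simp add: coprime_dvd_mult_right_iff)
  qed
  moreover have "card T = (\<Sum>c\<in>\<rho> ` T. card {t \<in> T. \<rho> t = c})"
    by (subst card_UN_disjoint[symmetric]) (auto simp: T_def intro!: arg_cong[of _ _ card])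
  ultimately have "card T \<le> card (\<rho> ` T) * (X div p ^ j + 1)"
    by (metis (no_types, lifting) sum_bounded_above of_nat_id)
  also have "\<dots> \<le> degree f * (X div p ^ j + 1)"
    using \<open>card (\<rho> ` T) \<le> degree f\<close> by (intro mult_right_mono) auto
  finally show ?thesis unfolding T_def .
qed

section \<open>Primes with a root of a given polynomial\<close>

lemma power_dvd_fact:
  assumes "p > 0"
  shows "p ^ k dvd (fact (p * k) :: nat)"
proof (induction k)
  case (Suc k)
  have "p * Suc k = Suc (p * k + (p - 1))" using assms by (cases p) auto
  then have "(fact (p * Suc k) :: nat) = (p * Suc k) * fact (p * k + (p - 1))"
    by (metis fact_Suc of_nat_id)
  moreover have "p ^ k dvd (fact (p * k + (p - 1)) :: nat)"
    by (rule dvd_trans[OF Suc fact_dvd]) simp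
  ultimately show ?case by (simp add: mult_dvd_mono mult.assoc)
qed simp

lemma geometric_sum_le:
  fixes x :: real
  assumes "0 \<le> x" "x \<le> 1 / 2"
  shows "(\<Sum>j = 1..n. x ^ j) \<le> 2 * x"
proof -
  have "(\<Sum>j = 1..n. x ^ j) \<le> 2 * x - 2 * x ^ Suc n"
  proof (induction n)
    case (Suc n)
    have "2 * x ^ Suc (Suc n) \<le> x ^ Suc n"
      using mult_right_mono[of "2 * x" 1 "x ^ Suc n"] assms by simp
    then show ?case using Suc by simp
  qed simp
  then show ?thesis using assms by (smt (verit) zero_le_power)
qed

text \<open>A crude form of Mertens' theorem. The product of \<open>p ^ (n div p)\<close> over the primes up to
\<open>n\<close> divides \<open>fact n\<close>, and \<open>n div p \<ge> n / (2 * p)\<close>. The order of magnitude is essential: with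
\<open>(ln n)\<^sup>2\<close>, the order of the same sum over all integers up to \<open>n\<close>, the final count of primes
would be below every power of \<open>y\<close>.\<close>

lemma sum_ln_prime_over_prime_le:
  fixes n :: nat
  assumes n: "n \<ge> 1"
  shows "(\<Sum>p :: nat | prime p \<and> p \<le> n. ln p / p) \<le> 2 * ln (real n)"
proof -
  let ?P = "{p::nat. prime p \<and> p \<le> n}"
  have fin: "finite ?P" by simp
  have "(\<Prod>p\<in>T. p ^ (n div p)) dvd (fact n :: nat)" if "finite T" "T \<subseteq> ?P" for T
    using that
  proof (induction T rule: finite_induct)
    case (insert p T)
    have "coprime (p ^ (n div p)) (\<Prod>q\<in>T. q ^ (n div q))"
    proof (intro prod_coprime_right)
      fix q assume q: "q \<in> T"
      then have "coprime p q" using insert by (intro primes_coprime) auto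
      then show "coprime (p ^ (n div p)) (q ^ (n div q))" by simp
    qed
    moreover have "p ^ (n div p) dvd (fact n :: nat)"
      using insert by (intro dvd_trans[OF power_dvd_fact fact_dvd]) (auto simp: prime_gt_0_nat)
    ultimately show ?case using insert by (simp add: divides_mult)
  qed simp
  then have "(\<Prod>p\<in>?P. p ^ (n div p)) \<le> (fact n :: nat)"
    using fin by (intro dvd_imp_le) auto
  also have "(fact n :: nat) \<le> n ^ n" by (metis fact_le_power of_nat_id)
  finally have le: "real (\<Prod>p\<in>?P. p ^ (n div p)) \<le> real (n ^ n)" by (simp only: of_nat_le_iff)
  have pos: "real (\<Prod>p\<in>?P. p ^ (n div p)) > 0"
    unfolding of_nat_0_less_iff by (intro prod_pos) (auto simp: prime_gt_0_nat)
  have "(\<Sum>p\<in>?P. n div p * ln p) = ln (real (\<Prod>p\<in>?P. p ^ (n div p)))"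
    by (subst of_nat_prod, subst ln_prod) (auto simp: ln_realpow prime_gt_0_nat)
  also have "\<dots> \<le> ln (real (n ^ n))" using le pos by (subst ln_le_cancel_iff) (use n in auto)
  also have "\<dots> = n * ln n" using n by (simp add: ln_realpow)
  finally have "(\<Sum>p\<in>?P. n div p * ln p) \<le> n * ln n" .
  moreover have "(\<Sum>p\<in>?P. n / 2 * (ln p / p)) \<le> (\<Sum>p\<in>?P. n div p * ln p)"
  proof (intro sum_mono)
    fix p assume p: "p \<in> ?P"
    then have p1: "p \<ge> 1" using prime_ge_1_nat by blast
    have "n < (n div p + 1) * p" using p1 using dividend_less_div_times[of p n] by (simp add: algebra_simps)
    moreover have "n div p \<ge> 1" using p p1 by (simp add: div_greater_zero_iff Suc_le_eq)
    then have "(n div p + 1) * p \<le> 2 * (n div p) * p" by (intro mult_right_mono) auto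
    ultimately have "n \<le> 2 * (n div p) * p" by linarith
    then have "real n \<le> 2 * real (n div p) * real p" by (metis of_nat_le_iff of_nat_mult of_nat_numeral)
    then have "real n / 2 / p \<le> real (n div p)" using p1 by (simp add: field_simps)
    then have "real n / 2 / p * ln p \<le> real (n div p) * ln p" using p1 by (intro mult_right_mono) auto
    then show "n / 2 * (ln p / p) \<le> n div p * ln p" by simp
  qed
  ultimately have "n / 2 * (\<Sum>p\<in>?P. ln p / p) \<le> n * ln n" by (simp add: sum_distrib_left)
  then show ?thesis using n by (simp add: field_simps)
qed

text \<open>Among sets of \<open>s\<close> primes, the worst case consists of small primes: those above \<open>s\<close> contribute at
most \<open>ln s / s\<close> each, as \<open>ln x / x\<close> decreases from \<open>e\<close> on.\<close>

lemma sum_ln_over_prime_set_le: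
  fixes S :: "nat set"
  assumes S: "finite S" "\<And>p. p \<in> S \<Longrightarrow> prime p" and s: "card S \<le> s" "s \<ge> 3"
  shows "(\<Sum>p\<in>S. ln p / p) \<le> 3 * ln (real s)"
proof -
  let ?small = "{p \<in> S. p \<le> s}" and ?large = "{p \<in> S. p > s}"
  have split: "S = ?small \<union> ?large" "?small \<inter> ?large = {}" by auto
  have "(\<Sum>p\<in>?small. ln p / p) \<le> (\<Sum>p :: nat | prime p \<and> p \<le> s. ln p / p)"
  proof (intro sum_mono2)
    fix p assume "p \<in> {p. prime p \<and> p \<le> s} - ?small"
    then have "p \<ge> 1" using prime_ge_1_nat by blast
    then show "0 \<le> ln p / p" by simp
  qed (use S in auto)
  also have "\<dots> \<le> 2 * ln s" using s by (intro sum_ln_prime_over_prime_le) simp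
  finally have 1: "(\<Sum>p\<in>?small. ln p / p) \<le> 2 * ln s" .
  have "(\<Sum>p\<in>?large. ln p / p) \<le> of_nat (card ?large) * (ln s / s)"
  proof (intro sum_bounded_above)
    fix p assume "p \<in> ?large"
    then show "ln p / p \<le> ln s / s"
      using s exp_le by (intro ln_x_over_x_mono) auto
  qed
  also have "\<dots> \<le> s * (ln s / s)"
    using s S card_mono[of S ?large] by (intro mult_right_mono) auto
  also have "\<dots> = ln s" using s by simp
  finally have 2: "(\<Sum>p\<in>?large. ln p / p) \<le> ln s" .
  have "(\<Sum>p\<in>S. ln p / p) = (\<Sum>p\<in>?small. ln p / p) + (\<Sum>p\<in>?large. ln p / p)"
    by (subst split(1), rule sum.union_disjoint) (use S split in auto)
  then show ?thesis using 1 2 by linarith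
qed

lemma ln_eq_sum_prime_powers:
  fixes m :: nat
  assumes m: "m > 0" and S: "finite S" "prime_factors m \<subseteq> S" "\<And>p. p \<in> S \<Longrightarrow> prime p"
    and J: "\<And>p j. p \<in> S \<Longrightarrow> p ^ j dvd m \<Longrightarrow> j \<le> J p"
  shows "ln (real m) = (\<Sum>p\<in>S. ln p * card {j \<in> {1..J p}. p ^ j dvd m})"
proof -
  have "m = (\<Prod>p\<in>prime_factors m. p ^ multiplicity p m)" using m by (simp add: prod_prime_factors)
  also have "\<dots> = (\<Prod>p\<in>S. p ^ multiplicity p m)"
  proof (intro prod.mono_neutral_left ballI)
    fix p assume "p \<in> S - prime_factors m"
    then show "p ^ multiplicity p m = 1" using S(3)[of p] m
      by (simp add: prime_factors_multiplicity)
  qed (use S in auto)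
  finally have "ln (real m) = ln (real (\<Prod>p\<in>S. p ^ multiplicity p m))" by simp
  also have "\<dots> = (\<Sum>p\<in>S. multiplicity p m * ln p)"
    using S by (subst of_nat_prod, subst ln_prod) (auto simp: ln_realpow prime_gt_0_nat)
  also have "\<dots> = (\<Sum>p\<in>S. ln p * card {j \<in> {1..J p}. p ^ j dvd m})"
  proof (intro sum.cong refl)
    fix p assume p: "p \<in> S"
    have iff: "p ^ j dvd m \<longleftrightarrow> j \<le> multiplicity p m" for j
      using S(3)[OF p] m by (intro power_dvd_iff_le_multiplicity) (auto simp: not_prime_unit)
    have "multiplicity p m \<le> J p" using J[OF p] iff by blast
    then have "{j \<in> {1..J p}. p ^ j dvd m} = {1..multiplicity p m}" by (auto simp: iff)
    then show "multiplicity p m * ln p = ln p * card {j \<in> {1..J p}. p ^ j dvd m}" by simp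
  qed
  finally show ?thesis .
qed

text \<open>Factor the product of the \<open>X\<close> numbers \<open>G t\<close>, which is at least \<open>X ^ X\<close>. A good prime \<open>p\<close>
enters with exponent at most \<open>degree f\<close> times \<open>2 * X / p + ln M / ln p\<close>; summing \<open>ln p\<close> times this over \<open>S\<close>
gives the right-hand side. If \<open>M\<close> is a power of \<open>X\<close>, the inequality fails when \<open>s\<close> is a small power of
\<open>X\<close>.\<close>

lemma values_need_many_primes:
  fixes f :: "int poly" and a w V :: int and G :: "nat \<Rightarrow> nat" and S :: "nat set"
  assumes vals: "\<And>t. t \<in> {1..X} \<Longrightarrow> poly f (a + w * int t) = V * int (G t)"
    and G: "\<And>t. t \<in> {1..X} \<Longrightarrow> X \<le> G t \<and> G t \<le> M" and X: "X \<ge> 1"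
    and S: "finite S" "\<And>t. t \<in> {1..X} \<Longrightarrow> prime_factors (G t) \<subseteq> S"
    and good: "\<And>p. p \<in> S \<Longrightarrow> prime p \<and> \<not> int p dvd lead_coeff f \<and> \<not> int p dvd w \<and>
                 (\<forall>x. int p dvd poly f x \<longrightarrow> \<not> int p dvd poly (pderiv f) x)"
    and s: "card S \<le> s" "s \<ge> 3"
  shows "X * ln X \<le> 6 * degree f * X * ln s + degree f * s * ln M"
proof -
  let ?r = "real (degree f)"
  have M: "M \<ge> 1" using G[of 1] X by auto
  \<comment> \<open>As \<open>G t \<le> M\<close>, exponents of \<open>p\<close> beyond \<open>J p\<close> do not occur.\<close>
  define J where "J p = nat \<lfloor>log p M\<rfloor>" for p :: nat
  have p2: "p \<ge> 2" if "p \<in> S" for p using good[OF that] prime_ge_2_nat by blast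
  have J_ln: "ln p * J p \<le> ln M" if "p \<in> S" for p
  proof -
    have "real (J p) \<le> log p M" using p2[OF that] M unfolding J_def by simp
    then have "ln p * J p \<le> ln p * log p M" using p2[OF that] by (intro mult_left_mono) auto
    also have "\<dots> = ln M" using p2[OF that] by (simp add: log_def)
    finally show ?thesis .
  qed
  have J_bound: "j \<le> J p" if "p \<in> S" "t \<in> {1..X}" "p ^ j dvd G t" for p j t
  proof -
    have "G t > 0" using G[OF that(2)] X by auto
    then have "p ^ j \<le> M" using dvd_imp_le[OF that(3)] G[OF that(2)] by linarith
    then have "real p ^ j \<le> real M" by (metis of_nat_le_iff of_nat_power)
    then have "real j \<le> log p M"
      using p2[OF that(1)] M by (simp add: le_log_iff powr_realpow)
    then show ?thesis unfolding J_def by linarith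
  qed
  have "X * ln X = (\<Sum>t\<in>{1..X}. ln (real X))" by simp
  also have "\<dots> \<le> (\<Sum>t\<in>{1..X}. ln (real (G t)))"
  proof (intro sum_mono)
    fix t assume "t \<in> {1..X}"
    then show "ln (real X) \<le> ln (real (G t))" using G[of t] X by simp
  qed
  also have "\<dots> = (\<Sum>t\<in>{1..X}. \<Sum>p\<in>S. ln p * card {j \<in> {1..J p}. p ^ j dvd G t})"
  proof (intro sum.cong refl)
    fix t assume t: "t \<in> {1..X}"
    show "ln (real (G t)) = (\<Sum>p\<in>S. ln p * card {j \<in> {1..J p}. p ^ j dvd G t})"
      using G[OF t] X S(2)[OF t] good J_bound[OF _ t] by (intro ln_eq_sum_prime_powers S(1)) auto
  qed
  also have "\<dots> = (\<Sum>p\<in>S. ln p * (\<Sum>t\<in>{1..X}. card {j \<in> {1..J p}. p ^ j dvd G t}))"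
    by (subst sum.swap) (simp add: sum_distrib_left)
  also have "\<dots> \<le> (\<Sum>p\<in>S. ?r * (2 * X * (ln p / p) + ln M))"
  proof (intro sum_mono)
    fix p assume p: "p \<in> S"
    have rp: "real p \<ge> 2" using p2[OF p] by simp
    have "(\<Sum>t\<in>{1..X}. card {j \<in> {1..J p}. p ^ j dvd G t})
        = (\<Sum>t\<in>{1..X}. \<Sum>j\<in>{1..J p}. if p ^ j dvd G t then 1 else 0)"
      by (simp add: sum.If_cases Int_def)
    also have "\<dots> = (\<Sum>j\<in>{1..J p}. \<Sum>t\<in>{1..X}. if p ^ j dvd G t then 1 else 0)"
      by (rule sum.swap)
    also have "\<dots> = (\<Sum>j\<in>{1..J p}. card {t \<in> {1..X}. p ^ j dvd G t})"
      by (simp add: sum.If_cases Int_def)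
    finally have "real (\<Sum>t\<in>{1..X}. card {j \<in> {1..J p}. p ^ j dvd G t})
        = (\<Sum>j\<in>{1..J p}. real (card {t \<in> {1..X}. p ^ j dvd G t}))" by simp
    also have "\<dots> \<le> (\<Sum>j\<in>{1..J p}. ?r * (X * (1 / p) ^ j + 1))"
    proof (intro sum_mono)
      fix j assume j: "j \<in> {1..J p}"
      have "card {t \<in> {1..X}. p ^ j dvd G t} \<le> card {t \<in> {1..X}. int p ^ j dvd poly f (a + w * int t)}"
      proof (intro card_mono subsetI)
        fix t assume t: "t \<in> {t \<in> {1..X}. p ^ j dvd G t}"
        then have "int p ^ j dvd int (G t)" by (simp flip: of_nat_power)
        then show "t \<in> {t \<in> {1..X}. int p ^ j dvd poly f (a + w * int t)}"
          using t vals[of t] by auto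
      qed simp
      also have "\<dots> \<le> degree f * (X div p ^ j + 1)"
        using good[OF p] j by (intro card_prime_power_dvd_values_le) auto
      finally have "real (card {t \<in> {1..X}. p ^ j dvd G t}) \<le> ?r * (real (X div p ^ j) + 1)"
        by (metis of_nat_le_iff of_nat_mult of_nat_add of_nat_1)
      also have "real (X div p ^ j) \<le> X / p ^ j" using of_nat_div_le_of_nat[of X "p ^ j", where 'a = real] by simp
      finally show "real (card {t \<in> {1..X}. p ^ j dvd G t}) \<le> ?r * (X * (1 / p) ^ j + 1)"
        by (simp add: power_one_over mult_left_mono)
    qed
    also have "\<dots> = ?r * (X * (\<Sum>j\<in>{1..J p}. (1 / p) ^ j) + J p)"
      by (simp add: sum.distrib distrib_left sum_distrib_left)
    also have "\<dots> \<le> ?r * (X * (2 / p) + J p)"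
    proof -
      have "(\<Sum>j\<in>{1..J p}. (1 / real p) ^ j) \<le> 2 / p"
      proof -
        have "1 / real p \<le> 1 / 2" using rp by (simp add: divide_left_mono)
        from geometric_sum_le[OF _ this] show ?thesis by simp
      qed
      then have "X * (\<Sum>j\<in>{1..J p}. (1 / real p) ^ j) + J p \<le> X * (2 / p) + J p"
        by (intro add_right_mono mult_left_mono) simp_all
      then show ?thesis by (rule mult_left_mono) simp
    qed
    finally have "ln p * real (\<Sum>t\<in>{1..X}. card {j \<in> {1..J p}. p ^ j dvd G t})
        \<le> ln p * (?r * (X * (2 / p) + J p))"
      by (rule mult_left_mono) (use rp in simp)
    also have "\<dots> = ?r * (2 * X * (ln p / p) + ln p * J p)" by (simp add: distrib_left mult_ac)
    also have "\<dots> \<le> ?r * (2 * X * (ln p / p) + ln M)"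
      by (intro mult_left_mono add_left_mono J_ln[OF p]) simp
    finally show "ln p * (\<Sum>t\<in>{1..X}. card {j \<in> {1..J p}. p ^ j dvd G t})
        \<le> ?r * (2 * X * (ln p / p) + ln M)" .
  qed
  also have "\<dots> = ?r * (2 * X * (\<Sum>p\<in>S. ln p / p) + card S * ln M)"
    by (simp only: sum_distrib_left[symmetric] sum.distrib sum_constant)
  also have "\<dots> \<le> ?r * (2 * X * (3 * ln s) + s * ln M)"
  proof -
    have "(\<Sum>p\<in>S. ln p / p) \<le> 3 * ln s"
      using good by (intro sum_ln_over_prime_set_le S(1) s) auto
    then have "2 * X * (\<Sum>p\<in>S. ln p / p) \<le> 2 * X * (3 * ln s)" by (rule mult_left_mono) simp
    moreover have "card S * ln M \<le> s * ln M" using s M by (intro mult_right_mono) auto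
    ultimately have "2 * X * (\<Sum>p\<in>S. ln p / p) + card S * ln M \<le> 2 * X * (3 * ln s) + s * ln M"
      by (rule add_mono)
    then show ?thesis by (rule mult_left_mono) simp
  qed
  finally show ?thesis by (simp add: algebra_simps)
qed

lemma abs_poly_le_power:
  fixes f :: "int poly"
  assumes "x \<ge> 1"
  shows "\<bar>poly f x\<bar> \<le> (\<Sum>i\<le>degree f. \<bar>coeff f i\<bar>) * x ^ degree f"
proof -
  have "\<bar>poly f x\<bar> \<le> (\<Sum>i\<le>degree f. \<bar>coeff f i * x ^ i\<bar>)"
    unfolding poly_altdef by (rule sum_abs)
  also have "\<dots> \<le> (\<Sum>i\<le>degree f. \<bar>coeff f i\<bar> * x ^ degree f)"
    using assms by (intro sum_mono) (auto simp: abs_mult intro!: mult_left_mono power_increasing)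
  finally show ?thesis by (simp add: sum_distrib_right)
qed

lemma monic_poly_ge_self:
  fixes f :: "int poly"
  assumes "lead_coeff f = 1" "degree f \<ge> 2"
  shows "\<exists>n\<ge>1. \<forall>x\<ge>n. poly f x \<ge> x"
proof -
  define g where "g = (of_int_poly f :: real poly) - [:0, 1:]"
  have "lead_coeff g > 0"
  proof -
    have "degree g = degree f"
      unfolding g_def diff_conv_add_uminus using assms by (subst degree_add_eq_left) auto
    then show ?thesis using assms unfolding g_def by (auto simp: coeff_pCons split: nat.splits)
  qed
  then obtain b where b: "\<And>x. x \<ge> b \<Longrightarrow> poly g x \<ge> lead_coeff g" using poly_pinfty_gt_lc by blast
  have "poly f x \<ge> x" if "x \<ge> max 1 \<lceil>b\<rceil>" for x
  proof -
    have "poly g (of_int x) \<ge> 0" using b[of "of_int x"] that \<open>lead_coeff g > 0\<close> by linarith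
    moreover have "poly g (of_int x) = of_int (poly f x - x)" by (simp add: g_def of_int_hom.poly_map_poly)
    ultimately show ?thesis by simp
  qed
  then show ?thesis by (intro exI[of _ "max 1 \<lceil>b\<rceil>"]) auto
qed

text \<open>The primes that divide \<open>D\<close> or \<open>E\<close> are avoided by a substitution. Let \<open>V = poly f n1\<close> be
positive and let \<open>E'\<close> be a multiple of \<open>V\<close>, \<open>D\<close> and \<open>E\<close>. The values of \<open>f\<close> on the progression
\<open>n1 + V * E' * t\<close> are \<open>V\<close> times integers that are \<open>1\<close> modulo \<open>E'\<close>; prime factors of the latter divide none of
\<open>V\<close>, \<open>D\<close>, \<open>E\<close>, and for \<open>p\<close> not dividing \<open>D\<close> all roots of \<open>f\<close> modulo \<open>p\<close> are simple.\<close>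

lemma root_primes_chebyshev:
  fixes f u v :: "int poly" and D :: int and E :: nat
  assumes monic: "lead_coeff f = 1" and deg: "degree f \<ge> 2"
    and bezout: "u * f + v * pderiv f = [:D:]" and D: "D \<noteq> 0" and E: "E > 0"
  shows "\<exists>C\<ge>1. \<forall>X\<ge>1. \<exists>S :: nat set. finite S \<and>
    (\<forall>p\<in>S. prime p \<and> p \<le> C * X ^ degree f \<and> \<not> p dvd E \<and>
        (\<exists>a. int p dvd poly f a \<and> \<not> int p dvd poly (pderiv f) a)) \<and>
    X * ln (real X) \<le> 6 * degree f * X * ln (real (max 3 (card S)))
        + degree f * max 3 (card S) * ln (real (C * X ^ degree f))"
proof -
  obtain n1 where n1: "n1 \<ge> 1" "\<And>x. x \<ge> n1 \<Longrightarrow> poly f x \<ge> x" using monic_poly_ge_self[OF monic deg] by blast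
  define V where "V = poly f n1"
  define E' where "E' = \<bar>D\<bar> * int E * V"
  define w where "w = V * E'"
  have V: "V \<ge> 1" using n1(1) n1(2)[of n1] unfolding V_def by linarith
  have "\<bar>D\<bar> * int E * V > 0" using V D E by (intro mult_pos_pos) auto
  then have E': "E' \<ge> 1" unfolding E'_def by linarith
  have "V * E' > 0" using V E' by (intro mult_pos_pos) auto
  then have w: "w \<ge> 1" unfolding w_def by linarith
  define L where "L = (\<Sum>i\<le>degree f. \<bar>coeff f i\<bar>)"
  have L: "L \<ge> 0" unfolding L_def by (intro sum_nonneg) auto
  define C where "C = nat (L * (n1 + 2 * w) ^ degree f) + 1"
  have simple: "\<not> int p dvd poly (pderiv f) x"
    if "prime p" "\<not> int p dvd D" "int p dvd poly f x" for p :: nat and x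
  proof
    assume "int p dvd poly (pderiv f) x"
    moreover have "poly u x * poly f x + poly v x * poly (pderiv f) x = D"
      using arg_cong[OF bezout, of "\<lambda>g. poly g x"] by simp
    ultimately show False using that by (metis dvd_add dvd_mult)
  qed
  have "\<exists>S :: nat set. finite S \<and>
    (\<forall>p\<in>S. prime p \<and> p \<le> C * X ^ degree f \<and> \<not> p dvd E \<and>
        (\<exists>a. int p dvd poly f a \<and> \<not> int p dvd poly (pderiv f) a)) \<and>
    X * ln (real X) \<le> 6 * degree f * X * ln (real (max 3 (card S)))
        + degree f * max 3 (card S) * ln (real (C * X ^ degree f))"
    if X: "X \<ge> 1" for X :: nat
  proof -
    \<comment> \<open>Starting the progression at \<open>t = X\<close> makes every \<open>G t\<close> at least \<open>X\<close>.\<close>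
    define a where "a = n1 + w * int X"
    have ex: "\<exists>z. poly f (a + w * int t) = V * (1 + E' * z)" for t
    proof -
      have "(a + w * int t) - n1 dvd poly f (a + w * int t) - V"
        unfolding V_def by (rule poly_diff_dvd)
      moreover have "w dvd (a + w * int t) - n1" by (simp add: a_def)
      ultimately have "w dvd poly f (a + w * int t) - V" by (rule dvd_trans[rotated])
      then obtain z where "poly f (a + w * int t) - V = w * z" by (elim dvdE)
      then show ?thesis by (intro exI[of _ z]) (simp add: w_def algebra_simps)
    qed
    then obtain z where z: "\<And>t. poly f (a + w * int t) = V * (1 + E' * z t)" by metis
    define G where "G t = nat (1 + E' * z t)" for t
    have ge: "1 + E' * z t \<ge> int X + 1" for t
    proof -
      have nonneg: "w * int X \<ge> 0" "w * int t \<ge> 0" using w by simp_all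
      have "poly f (a + w * int t) \<ge> a + w * int t"
        by (rule n1(2)) (use nonneg in \<open>simp add: a_def\<close>)
      then have "V * (1 + E' * z t) \<ge> n1 + w * int X"
        using nonneg unfolding z by (simp add: a_def)
      then have "V * (E' * int X) < V * (1 + E' * z t)"
        using n1(1) unfolding w_def by (simp add: mult.assoc)
      then have "E' * int X < 1 + E' * z t" using V by (simp add: mult_less_cancel_left_pos)
      moreover have "1 * int X \<le> E' * int X" using E' by (intro mult_right_mono) auto
      ultimately show ?thesis by linarith
    qed
    have G: "int (G t) = 1 + E' * z t" for t using ge[of t] by (simp add: G_def)
    have G_le: "G t \<le> C * X ^ degree f" if t: "t \<in> {1..X}" for t
    proof -
      have "w * int X \<ge> 0" "w * int t \<ge> 0" using w by simp_all
      then have n: "a + w * int t \<ge> 1" using n1(1) unfolding a_def by linarith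
      have "1 * int (G t) \<le> V * int (G t)" using V by (intro mult_right_mono) auto
      then have "int (G t) \<le> V * int (G t)" by simp
      also have "\<dots> = poly f (a + w * int t)" unfolding z G ..
      also have "\<dots> \<le> L * (a + w * int t) ^ degree f" using abs_poly_le_power[OF n, of f] unfolding L_def by linarith
      also have "\<dots> \<le> L * ((n1 + 2 * w) * int X) ^ degree f"
      proof (intro mult_left_mono power_mono)
        have "w * int t \<le> w * int X" using t w by (intro mult_left_mono) auto
        moreover have "n1 * 1 \<le> n1 * int X" using n1(1) X by (intro mult_left_mono) auto
        ultimately show "a + w * int t \<le> (n1 + 2 * w) * int X" by (simp add: a_def algebra_simps)
      qed (use L n in auto)
      also have "\<dots> = L * (n1 + 2 * w) ^ degree f * int X ^ degree f" by (simp add: power_mult_distrib)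
      also have "\<dots> \<le> int C * int X ^ degree f"
        unfolding C_def by (intro mult_right_mono) auto
      finally show ?thesis by (metis of_nat_le_iff of_nat_mult of_nat_power)
    qed
    define S where "S = (\<Union>t\<in>{1..X}. prime_factors (G t))"
    have Gpos: "G t > 0" for t using ge[of t] G[of t] by linarith
    have good: "prime p \<and> p \<le> C * X ^ degree f \<and> \<not> int p dvd E' \<and> (\<exists>x. int p dvd poly f x)" if p: "p \<in> S" for p
    proof -
      obtain t where "t \<in> {1..X}" "p \<in> prime_factors (G t)" using p unfolding S_def by blast
      then have t: "t \<in> {1..X}" "prime p" "p dvd G t"
        by (simp_all add: in_prime_factors_imp_prime in_prime_factors_imp_dvd)
      have pG: "int p dvd 1 + E' * z t" using t G by (metis int_dvd_int_iff)
      then have "int p dvd poly f (a + w * int t)" unfolding z by simp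
      moreover have "\<not> int p dvd E'"
      proof
        assume "int p dvd E'"
        then have "int p dvd (1 + E' * z t) - E' * z t" using pG by (intro dvd_diff dvd_mult2) auto
        then show False using t(2) by (simp add: not_prime_unit)
      qed
      moreover have "p \<le> C * X ^ degree f"
        using dvd_imp_le[OF t(3) Gpos] G_le[OF t(1)] by linarith
      ultimately show ?thesis using t(2) by blast
    qed
    have notD: "\<not> int p dvd D" "\<not> p dvd E" "\<not> int p dvd w" if p: "p \<in> S" for p
    proof -
      have nE: "\<not> int p dvd E'" "prime (int p)" using good[OF p] by auto
      then show "\<not> int p dvd D" unfolding E'_def by auto
      from nE show "\<not> p dvd E" unfolding E'_def by auto
      from nE show "\<not> int p dvd w" unfolding w_def E'_def by (auto simp: prime_dvd_mult_iff)
    qed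
    have bound: "X * ln (real X) \<le> 6 * degree f * X * ln (real (max 3 (card S)))
        + degree f * max 3 (card S) * ln (real (C * X ^ degree f))"
    proof (rule values_need_many_primes[where f = f and a = a and w = w and V = V and G = G and S = S])
      show "poly f (a + w * int t) = V * int (G t)" for t unfolding z G ..
      show "X \<le> G t \<and> G t \<le> C * X ^ degree f" if "t \<in> {1..X}" for t
        using G_le[OF that] ge[of t] G[of t] by linarith
      show "prime p \<and> \<not> int p dvd lead_coeff f \<and> \<not> int p dvd w \<and>
                 (\<forall>x. int p dvd poly f x \<longrightarrow> \<not> int p dvd poly (pderiv f) x)" if "p \<in> S" for p
        using good[OF that] notD[OF that] simple monic by (auto simp: not_prime_unit)
    qed (use X in \<open>auto simp: S_def\<close>)
    have fin: "finite S" by (simp add: S_def)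
    have "\<exists>a. int p dvd poly f a \<and> \<not> int p dvd poly (pderiv f) a" if "p \<in> S" for p
      using good[OF that] notD[OF that] simple by blast
    then have "\<forall>p\<in>S. prime p \<and> p \<le> C * X ^ degree f \<and> \<not> p dvd E \<and>
        (\<exists>a. int p dvd poly f a \<and> \<not> int p dvd poly (pderiv f) a)"
      using good notD(2) by simp
    with fin bound show ?thesis by (intro exI[of _ S] conjI)
  qed
  moreover have "C \<ge> 1" by (simp add: C_def)
  ultimately show ?thesis by blast
qed

text \<open>If the primes found for \<open>X\<close> were fewer than \<open>X powr \<eta>\<close> with \<open>\<eta> = 1 / (12 * degree f)\<close>, the
first term in the preceding bound would be at most half of \<open>X * ln X\<close> and the second would be negligible. Taking \<open>X\<close> about
\<open>y powr (1 / (2 * degree f))\<close> keeps these primes below \<open>y\<close>, and Hensel's lemma lifts the roots.\<close>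

theorem many_primes_with_roots:
  fixes f u v :: "int poly" and D :: int and E k :: nat
  assumes monic: "lead_coeff f = 1" and deg: "degree f \<ge> 2"
    and bezout: "u * f + v * pderiv f = [:D:]" and D: "D \<noteq> 0" and E: "E > 0"
  shows "\<exists>\<delta>>0. eventually (\<lambda>y. y powr \<delta> \<le>
    card {p :: nat. prime p \<and> real p \<le> y \<and> \<not> p dvd E \<and> (\<exists>a. int p ^ Suc k dvd poly f a)}) at_top"
proof -
  define r where "r = real (degree f)"
  have r: "r \<ge> 2" using deg by (simp add: r_def)
  obtain C where C: "C \<ge> 1" and cheb: "\<And>X. X \<ge> 1 \<Longrightarrow> \<exists>S :: nat set. finite S \<and>
    (\<forall>p\<in>S. prime p \<and> p \<le> C * X ^ degree f \<and> \<not> p dvd E \<and>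
        (\<exists>a. int p dvd poly f a \<and> \<not> int p dvd poly (pderiv f) a)) \<and>
    X * ln (real X) \<le> 6 * degree f * X * ln (real (max 3 (card S)))
        + degree f * max 3 (card S) * ln (real (C * X ^ degree f))"
    using root_primes_chebyshev[OF assms] by blast
  define \<eta> where "\<eta> = 1 / (12 * r)"
  have \<eta>: "\<eta> > 0" "\<eta> \<le> 1 / 2" using r by (auto simp: \<eta>_def field_simps)
  define lc where "lc = ln (real C)"
  define Z where "Z y = nat \<lfloor>y powr (1 / (2 * r))\<rfloor>" for y :: real
  have r0: "r > 0" using r by simp
  have ev1: "\<forall>\<^sub>F x in at_top. r * x powr (1/2) * (lc + r * ln x) < x * ln x / 2"
    using r0 by real_asymp
  have ev2: "\<forall>\<^sub>F x in at_top. x powr \<eta> > 3" using \<eta>(1) by real_asymp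
  have limZ: "filterlim (\<lambda>y. real (Z y)) at_top at_top"
    unfolding Z_def using r0 by real_asymp
  have ev4: "\<forall>\<^sub>F y in at_top. y powr (1 / (4 * r)) \<le> real (Z y)"
  proof -
    have "\<forall>\<^sub>F z :: real in at_top. z \<le> z * z - 1" by real_asymp
    moreover have "filterlim (\<lambda>y :: real. y powr (1 / (4 * r))) at_top at_top" using r0 by real_asymp
    ultimately have "\<forall>\<^sub>F y in at_top. y powr (1 / (4 * r)) \<le> y powr (1 / (4 * r)) * y powr (1 / (4 * r)) - 1"
      by (rule eventually_compose_filterlim)
    then show ?thesis
    proof eventually_elim
      case (elim y)
      then show ?case unfolding Z_def powr_add[symmetric] by simp linarith
    qed
  qed
  have ev5: "\<forall>\<^sub>F y in at_top. real C * y powr (1/2) \<le> y" by real_asymp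
  have "\<forall>\<^sub>F y in at_top. y powr (\<eta> / (4 * r)) \<le>
    card {p :: nat. prime p \<and> real p \<le> y \<and> \<not> p dvd E \<and> (\<exists>a. int p ^ Suc k dvd poly f a)}"
    using eventually_compose_filterlim[OF ev1 limZ] eventually_compose_filterlim[OF ev2 limZ]
      ev4 ev5
  proof eventually_elim
    case (elim y)
    define X where "X = Z y"
    define T where "T = {p :: nat. prime p \<and> real p \<le> y \<and> \<not> p dvd E \<and> (\<exists>a. int p ^ Suc k dvd poly f a)}"
    have X1: "X \<ge> 1" using elim(2) by (cases X) (auto simp: X_def)
    obtain S where S: "finite S" "\<And>p. p \<in> S \<Longrightarrow> prime p \<and> p \<le> C * X ^ degree f \<and> \<not> p dvd E \<and>
        (\<exists>a. int p dvd poly f a \<and> \<not> int p dvd poly (pderiv f) a)"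
      "X * ln (real X) \<le> 6 * degree f * X * ln (real (max 3 (card S)))
        + degree f * max 3 (card S) * ln (real (C * X ^ degree f))"
      using cheb[OF X1] by blast
    have lnM: "ln (real (C * X ^ degree f)) = lc + r * ln X"
      using C X1 by (simp add: ln_mult ln_realpow lc_def r_def)
    have "real (max 3 (card S)) \<ge> X powr \<eta>"
    proof (rule ccontr)
      assume "\<not> ?thesis"
      then have lt: "real (max 3 (card S)) \<le> X powr \<eta>" by simp
      have "ln (real (max 3 (card S))) \<le> ln (X powr \<eta>)" using lt X1 by (subst ln_le_cancel_iff) auto
      also have "\<dots> = \<eta> * ln X" using X1 by (simp add: ln_powr)
      finally have l: "ln (real (max 3 (card S))) \<le> \<eta> * ln X" .
      have "X * ln (real X) \<le> 6 * r * X * ln (real (max 3 (card S)))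
        + r * real (max 3 (card S)) * (lc + r * ln X)"
        using S(3) unfolding lnM by (simp add: r_def)
      also have "\<dots> \<le> 6 * r * X * (\<eta> * ln X) + r * X powr (1/2) * (lc + r * ln X)"
      proof (intro add_mono)
        show "6 * r * X * ln (real (max 3 (card S))) \<le> 6 * r * X * (\<eta> * ln X)"
          using l r by (intro mult_left_mono) auto
        have "X powr \<eta> \<le> X powr (1/2)" using X1 \<eta> by (intro powr_mono) auto
        then have "real (max 3 (card S)) \<le> X powr (1/2)" using lt by linarith
        moreover have "lc + r * ln X \<ge> 0" using C X1 r by (auto simp: lc_def)
        ultimately show "r * real (max 3 (card S)) * (lc + r * ln X) \<le> r * X powr (1/2) * (lc + r * ln X)"
          using r by (intro mult_right_mono mult_left_mono) auto
      qed
      also have "6 * r * X * (\<eta> * ln X) = X * ln X / 2" using r by (simp add: \<eta>_def)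
      finally show False using elim(1) unfolding X_def by linarith
    qed
    moreover have "X powr \<eta> > 3" using elim(2) by (simp add: X_def)
    ultimately have cardS: "X powr \<eta> \<le> card S" by (simp add: max_def split: if_splits)
    have "S \<subseteq> T"
    proof
      fix p assume p: "p \<in> S"
      have "real p \<le> real (C * X ^ degree f)" using S(2)[OF p] by (simp only: of_nat_le_iff)
      also have "\<dots> = C * (real X) powr r" using X1 by (simp add: r_def powr_realpow)
      also have "\<dots> \<le> C * (y powr (1 / (2 * r))) powr r"
        using r by (intro mult_left_mono powr_mono2) (auto simp: X_def Z_def)
      also have "\<dots> = C * y powr (1/2)" using r by (simp add: powr_powr)
      also have "\<dots> \<le> y" using elim(4) .
      finally have "real p \<le> y" .
      moreover obtain a where "int p dvd poly f a" "\<not> int p dvd poly (pderiv f) a" "prime p" "\<not> p dvd E"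
        using S(2)[OF p] by blast
      moreover from this have "\<exists>b. int p ^ Suc k dvd poly f b" using hensel_lift[of "int p" f a k] by auto
      ultimately show "p \<in> T" by (simp add: T_def)
    qed
    moreover have "finite T"
      by (rule finite_subset[of _ "{..nat \<lfloor>y\<rfloor>}"]) (auto simp: T_def le_nat_floor)
    ultimately have "card S \<le> card T" by (intro card_mono)
    have "y powr (\<eta> / (4 * r)) = (y powr (1 / (4 * r))) powr \<eta>" by (simp add: powr_powr)
    also have "\<dots> \<le> X powr \<eta>" using elim(3) \<eta> by (intro powr_mono2) (auto simp: X_def)
    also have "\<dots> \<le> card T" using cardS \<open>card S \<le> card T\<close> by linarith
    finally show ?case unfolding T_def .
  qed
  moreover have "\<eta> / (4 * r) > 0" using \<eta> r by simp
  ultimately show ?thesis by blast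
qed

section \<open>Primitive elements\<close>

text \<open>Gaussian elimination without division. The general coefficient ring matters: the lemma is used over
the rationals and over the polynomials in one variable.\<close>

lemma linear_dependence_idom:
  fixes u :: "'i \<Rightarrow> 'j \<Rightarrow> 'a::idom"
  assumes "finite J" "finite I" "card J < card I"
  shows "\<exists>c. (\<exists>n\<in>I. c n \<noteq> 0) \<and> (\<forall>j\<in>J. (\<Sum>n\<in>I. c n * u n j) = 0)"
  using assms
proof (induction J arbitrary: I u rule: finite_induct)
  case empty
  then have "I \<noteq> {}" by auto
  then show ?case by (intro exI[of _ "\<lambda>_. 1"]) auto
next
  case (insert j0 J)
  show ?case
  proof (cases "\<forall>n\<in>I. u n j0 = 0")
    case True
    have "card J < card I" using insert by simp
    then obtain c where c: "\<exists>n\<in>I. c n \<noteq> 0" "\<forall>j\<in>J. (\<Sum>n\<in>I. c n * u n j) = 0"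
      using insert.IH[OF insert.prems(1)] by blast
    have "(\<Sum>n\<in>I. c n * u n j0) = 0" using True by simp
    then show ?thesis using c by (intro exI[of _ c]) auto
  next
    case False
    then obtain k where k: "k \<in> I" "u k j0 \<noteq> 0" by blast
    let ?I = "I - {k}"
    have "card J < card ?I" "finite ?I" using insert k by auto
    from insert.IH[OF this(2,1), of "\<lambda>n j. u k j0 * u n j - u n j0 * u k j"]
    obtain c where c: "\<exists>n\<in>?I. c n \<noteq> 0"
      "\<forall>j\<in>J. (\<Sum>n\<in>?I. c n * (u k j0 * u n j - u n j0 * u k j)) = 0" by blast
    define c' where "c' n = (if n = k then - (\<Sum>m\<in>?I. c m * u m j0) else u k j0 * c n)" for n
    have sum: "(\<Sum>n\<in>I. c' n * u n j) = (\<Sum>n\<in>?I. c n * (u k j0 * u n j - u n j0 * u k j))" for j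
    proof -
      have "(\<Sum>n\<in>I. c' n * u n j) = c' k * u k j + (\<Sum>n\<in>?I. c' n * u n j)"
        using k insert by (simp add: sum.remove)
      also have "(\<Sum>n\<in>?I. c' n * u n j) = (\<Sum>n\<in>?I. u k j0 * c n * u n j)"
        by (intro sum.cong) (auto simp: c'_def)
      also have "c' k * u k j = - (\<Sum>n\<in>?I. c n * u n j0 * u k j)"
        by (simp add: c'_def sum_distrib_right)
      finally show ?thesis by (simp add: sum_subtractf right_diff_distrib mult_ac)
    qed
    have "\<forall>j\<in>insert j0 J. (\<Sum>n\<in>I. c' n * u n j) = 0"
      using c(2) by (auto simp: sum)
    moreover have "\<exists>n\<in>I. c' n \<noteq> 0" using c(1) k by (auto simp: c'_def)
    ultimately show ?thesis by blast
  qed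
qed

abbreviation rat_eval :: "rat poly \<Rightarrow> 'k::field_char_0 \<Rightarrow> 'k" where
  "rat_eval h x \<equiv> poly (map_poly of_rat h) x"

interpretation of_rat_poly_hom: map_poly_inj_idom_hom of_rat ..

lemmas rat_eval_simps = of_rat_poly_hom.hom_add of_rat_poly_hom.hom_mult
  of_rat_hom.map_poly_pCons_hom of_rat_hom.map_poly_hom_smult

text \<open>For \<open>x\<close> algebraic over the rationals this ring is already the field generated by \<open>x\<close>, see
\<open>inverse_in_rat_adjoin\<close>.\<close>

definition rat_adjoin :: "'k::field_char_0 \<Rightarrow> 'k set" where
  "rat_adjoin x = range (\<lambda>h. rat_eval h x)"

lemma rat_adjoin_of_rat: "of_rat q \<in> rat_adjoin x"
  unfolding rat_adjoin_def by (rule range_eqI[of _ _ "[:q:]"]) (simp add: rat_eval_simps)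

lemma rat_adjoin_self: "x \<in> rat_adjoin x"
  unfolding rat_adjoin_def by (rule range_eqI[of _ _ "[:0, 1:]"]) (simp add: rat_eval_simps)

lemma rat_adjoin_add: "a \<in> rat_adjoin x \<Longrightarrow> b \<in> rat_adjoin x \<Longrightarrow> a + b \<in> rat_adjoin x"
  unfolding rat_adjoin_def
proof clarify
  fix g h show "rat_eval g x + rat_eval h x \<in> range (\<lambda>h. rat_eval h x)"
    by (rule range_eqI[of _ _ "g + h"]) (simp add: rat_eval_simps)
qed

lemma rat_adjoin_mult: "a \<in> rat_adjoin x \<Longrightarrow> b \<in> rat_adjoin x \<Longrightarrow> a * b \<in> rat_adjoin x"
  unfolding rat_adjoin_def
proof clarify
  fix g h show "rat_eval g x * rat_eval h x \<in> range (\<lambda>h. rat_eval h x)"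
    by (rule range_eqI[of _ _ "g * h"]) (simp add: rat_eval_simps)
qed

lemma rat_adjoin_uminus: "a \<in> rat_adjoin x \<Longrightarrow> - a \<in> rat_adjoin x"
  using rat_adjoin_mult[OF rat_adjoin_of_rat[of "- 1"]] by fastforce

lemma rat_adjoin_sum: "(\<And>i. i \<in> I \<Longrightarrow> f i \<in> rat_adjoin x) \<Longrightarrow> sum f I \<in> rat_adjoin x"
  using rat_adjoin_of_rat[of 0 x] rat_adjoin_add by (induction I rule: infinite_finite_induct) auto

lemma rat_adjoin_subset:
  assumes "x \<in> rat_adjoin y"
  shows "rat_adjoin x \<subseteq> rat_adjoin y"
proof -
  have "rat_eval h x \<in> rat_adjoin y" for h
    by (induction h)
      (use assms rat_adjoin_of_rat[of 0 y] in \<open>auto simp: rat_eval_simps intro!: rat_adjoin_add rat_adjoin_mult rat_adjoin_of_rat\<close>)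
  then show ?thesis unfolding rat_adjoin_def by blast
qed

context
  fixes K :: "'k::field_char_0 set"
  assumes K: "number_field K"
begin

lemma number_field_subspace: "rat_vs.subspace K"
  using K unfolding number_field_def by (metis rat_vs.subspace_span)

lemma number_field_add: "x \<in> K \<Longrightarrow> y \<in> K \<Longrightarrow> x + y \<in> K"
  using number_field_subspace by (rule rat_vs.subspace_add)

lemma number_field_mult: "x \<in> K \<Longrightarrow> y \<in> K \<Longrightarrow> x * y \<in> K"
  using K unfolding number_field_def by blast

lemma number_field_of_rat: "of_rat q \<in> K"
  using rat_vs.subspace_scale[OF number_field_subspace, of 1 q] K
  unfolding number_field_def by simp

lemma number_field_power: "x \<in> K \<Longrightarrow> x ^ n \<in> K"
  using K by (induction n) (auto intro: number_field_mult simp: number_field_def)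

lemma number_field_sum: "(\<And>i. i \<in> I \<Longrightarrow> f i \<in> K) \<Longrightarrow> sum f I \<in> K"
  using number_field_subspace by (rule rat_vs.subspace_sum)

lemma rat_adjoin_subset_number_field:
  assumes "x \<in> K"
  shows "rat_adjoin x \<subseteq> K"
proof -
  have "rat_eval h x \<in> K" for h
    by (induction h)
      (use assms number_field_of_rat[of 0] in \<open>auto simp: rat_eval_simps intro!: number_field_add number_field_mult number_field_of_rat\<close>)
  then show ?thesis unfolding rat_adjoin_def by blast
qed

lemma number_field_relation:
  assumes "y \<in> K"
  shows "\<exists>h. h \<noteq> 0 \<and> rat_eval h y = 0"
proof -
  obtain S where S: "finite S" "rat_vs.span S = K" using K unfolding number_field_def by blast
  have "\<exists>q. y ^ n = (\<Sum>b\<in>S. of_rat (q b) * b)" for n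
    using number_field_power[OF assms, of n] S rat_vs.span_finite[OF S(1)] by auto
  then obtain q where q: "\<And>n. y ^ n = (\<Sum>b\<in>S. of_rat (q n b) * b)" by metis
  obtain c where c: "\<exists>n\<in>{..card S}. c n \<noteq> 0" "\<forall>b\<in>S. (\<Sum>n\<le>card S. c n * q n b) = 0"
    using linear_dependence_idom[OF S(1), of "{..card S}" q] by auto
  define h where "h = (\<Sum>n\<le>card S. monom (c n) n)"
  have coeff: "coeff h n = c n" if "n \<le> card S" for n
    using that by (simp add: h_def coeff_sum)
  have "rat_eval h y = (\<Sum>n\<le>card S. of_rat (c n) * y ^ n)"
    by (simp add: h_def of_rat_poly_hom.hom_sum poly_sum poly_monom)
  also have "\<dots> = (\<Sum>n\<le>card S. \<Sum>b\<in>S. of_rat (c n * q n b) * b)"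
    by (simp only: q sum_distrib_left of_rat_mult mult.assoc)
  also have "\<dots> = (\<Sum>b\<in>S. of_rat (\<Sum>n\<le>card S. c n * q n b) * b)"
    by (subst sum.swap) (simp only: sum_distrib_right of_rat_sum)
  also have "\<dots> = 0" using c(2) by simp
  finally have "rat_eval h y = 0" .
  moreover have "h \<noteq> 0" using c(1) coeff by fastforce
  ultimately show ?thesis by blast
qed

text \<open>A nonzero polynomial of least degree that vanishes at \<open>x \<noteq> 0\<close> has a nonzero constant term,
and solving for this term exhibits the inverse.\<close>

lemma inverse_in_rat_adjoin:
  assumes x: "x \<in> K"
  shows "inverse x \<in> rat_adjoin x"
proof (cases "x = 0")
  case True
  then show ?thesis using rat_adjoin_of_rat[of 0 x] by simp
next
  case False
  obtain h0 where "h0 \<noteq> 0 \<and> rat_eval h0 x = 0" using number_field_relation[OF x] by blast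
  from ex_has_least_nat[of "\<lambda>h. h \<noteq> 0 \<and> rat_eval h x = 0", OF this, of degree]
  obtain h where h: "h \<noteq> 0" "rat_eval h x = 0"
    and min: "\<And>g. g \<noteq> 0 \<Longrightarrow> rat_eval g x = 0 \<Longrightarrow> degree h \<le> degree g" by blast
  obtain a g where hg: "h = pCons a g" by (cases h)
  have *: "of_rat a + x * rat_eval g x = 0" using h(2) by (simp add: hg rat_eval_simps)
  have "a \<noteq> 0"
  proof
    assume "a = 0"
    then have "rat_eval g x = 0" "g \<noteq> 0" using * False h(1) hg by auto
    then show False using min[of g] hg by simp
  qed
  then have "inverse x = of_rat (- 1 / a) * rat_eval g x"
    using * False by (simp add: field_simps of_rat_divide of_rat_minus eq_neg_iff_add_eq_0)
  then show ?thesis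
    using rat_adjoin_mult[OF rat_adjoin_of_rat, of "rat_eval g x" x "- 1 / a"] by (simp add: rat_adjoin_def)
qed

text \<open>The element \<open>\<theta> + t \<beta>\<close> of the polynomial ring over \<open>K\<close> is algebraic over the rational polynomials in
\<open>t\<close>: with respect to a finite spanning set of \<open>K\<close>, its powers are vectors of such polynomials.\<close>

lemma pencil_relation:
  assumes "\<theta> \<in> K" "\<beta> \<in> K"
  shows "\<exists>d c. c d \<noteq> 0 \<and> (\<Sum>n\<le>d. map_poly of_rat (c n) * [:\<theta>, \<beta>:] ^ n) = 0"
proof -
  obtain S where S: "finite S" "rat_vs.span S = K" using K unfolding number_field_def by blast
  let ?y = "[:\<theta>, \<beta>:]"
  have coeffs: "coeff (?y ^ n) i \<in> K" for n i
  proof (induction n arbitrary: i)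
    case 0
    then show ?case using number_field_of_rat[of 0] number_field_of_rat[of 1] by (simp add: coeff_1)
  next
    case (Suc n)
    have "coeff (?y ^ Suc n) i = \<theta> * coeff (?y ^ n) i + (case i of 0 \<Rightarrow> 0 | Suc j \<Rightarrow> \<beta> * coeff (?y ^ n) j)"
      by (simp add: coeff_pCons split: nat.splits)
    then show ?case using Suc assms number_field_of_rat[of 0]
      by (auto intro!: number_field_add number_field_mult split: nat.splits)
  qed
  have "\<exists>q. coeff (?y ^ n) i = (\<Sum>b\<in>S. of_rat (q b) * b)" for n i
    using coeffs[of n i] S rat_vs.span_finite[OF S(1)] by auto
  then obtain q where q: "\<And>n i. coeff (?y ^ n) i = (\<Sum>b\<in>S. of_rat (q n i b) * b)" by metis
  define u where "u n b = (\<Sum>i\<le>degree (?y ^ n). monom (q n i b) i)" for n b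
  have power: "?y ^ n = (\<Sum>b\<in>S. smult b (map_poly of_rat (u n b)))" for n
  proof -
    have "?y ^ n = (\<Sum>i\<le>degree (?y ^ n). monom (coeff (?y ^ n) i) i)"
      by (rule poly_as_sum_of_monoms[symmetric])
    also have "\<dots> = (\<Sum>i\<le>degree (?y ^ n). \<Sum>b\<in>S. smult b (monom (of_rat (q n i b)) i))"
      by (simp add: q smult_monom mult.commute flip: monom_hom.hom_sum)
    also have "\<dots> = (\<Sum>b\<in>S. smult b (map_poly of_rat (u n b)))"
      by (subst sum.swap)
        (simp add: u_def of_rat_poly_hom.hom_sum of_rat_hom.map_poly_hom_monom smult_sum2)
    finally show ?thesis .
  qed
  obtain c where c: "\<exists>n\<in>{..card S}. c n \<noteq> 0" "\<forall>b\<in>S. (\<Sum>n\<le>card S. c n * u n b) = 0"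
    using linear_dependence_idom[OF S(1), of "{..card S}" u] by auto
  have "(\<Sum>n\<le>card S. map_poly of_rat (c n) * ?y ^ n)
      = (\<Sum>n\<le>card S. \<Sum>b\<in>S. smult b (map_poly of_rat (c n * u n b)))"
    by (simp only: power sum_distrib_left of_rat_poly_hom.hom_mult mult_smult_right)
  also have "\<dots> = (\<Sum>b\<in>S. smult b (map_poly of_rat (\<Sum>n\<le>card S. c n * u n b)))"
    by (subst sum.swap) (simp only: of_rat_poly_hom.hom_sum smult_sum2)
  also have "\<dots> = 0" using c(2) by simp
  finally have rel: "(\<Sum>n\<le>card S. map_poly of_rat (c n) * ?y ^ n) = 0" .
  define d where "d = Max {n \<in> {..card S}. c n \<noteq> 0}"
  have d: "d \<in> {n \<in> {..card S}. c n \<noteq> 0}" unfolding d_def using c(1) by (intro Max_in) auto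
  have "c n = 0" if "n \<in> {..card S} - {..d}" for n
  proof (rule ccontr)
    assume "c n \<noteq> 0"
    then have "n \<le> d" unfolding d_def using that by (intro Max_ge) auto
    then show False using that by simp
  qed
  then have "(\<Sum>n\<le>card S. map_poly of_rat (c n) * ?y ^ n) = (\<Sum>n\<le>d. map_poly of_rat (c n) * ?y ^ n)"
    using d by (intro sum.mono_neutral_right) auto
  then show ?thesis using rel d by (intro exI[of _ d] exI[of _ c]) auto
qed

text \<open>Take an algebraic relation \<open>P(t, \<theta> + t \<beta>) = 0\<close> whose degree in the second variable is least, and
differentiate it with respect to \<open>t\<close>. The outcome, \<open>P_1(t, \<theta> + t \<beta>) + \<beta> P_2(t, \<theta> + t \<beta>) = 0\<close>, has
\<open>P_2(t, \<theta> + t \<beta>) \<noteq> 0\<close> by minimality. Specialising \<open>t\<close> to an integer \<open>m\<close> that is not a root of this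
polynomial expresses \<open>\<beta>\<close> rationally in \<open>\<gamma> = \<theta> + m \<beta>\<close>.\<close>

lemma adjoin_two:
  assumes \<theta>: "\<theta> \<in> K" and \<beta>: "\<beta> \<in> K"
  shows "\<exists>\<gamma>\<in>K. \<theta> \<in> rat_adjoin \<gamma> \<and> \<beta> \<in> rat_adjoin \<gamma>"
proof -
  let ?y = "[:\<theta>, \<beta>:]"
  let ?Q = "\<lambda>h :: rat poly. map_poly of_rat h :: 'k poly"
  define R where "R d c \<longleftrightarrow> c d \<noteq> 0 \<and> (\<Sum>n\<le>d. ?Q (c n) * ?y ^ n) = 0" for d c
  have "\<exists>d. \<exists>c. R d c" unfolding R_def by (rule pencil_relation[OF assms])
  define d where "d = (LEAST d. \<exists>c. R d c)"
  obtain c where c: "R d c" using LeastI_ex[OF \<open>\<exists>d. \<exists>c. R d c\<close>] unfolding d_def by blast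
  have min: "\<not> R e c'" if "e < d" for e c' using not_less_Least that unfolding d_def by blast
  have "d \<noteq> 0" using c by (auto simp: R_def)
  then obtain e where e: "d = Suc e" by (cases d) auto
  define D where "D = (\<Sum>n\<le>e. ?Q (of_nat (Suc n) * c (Suc n)) * ?y ^ n)"
  have "D \<noteq> 0"
  proof
    assume "D = 0"
    moreover have "(of_nat (Suc e) :: rat poly) \<noteq> 0" by (simp del: of_nat_Suc)
    ultimately have "R e (\<lambda>n. of_nat (Suc n) * c (Suc n))"
      using c unfolding R_def D_def e by (simp del: of_nat_Suc)
    then show False using min e by blast
  qed
  have deriv_y: "pderiv (?y ^ n) = of_nat n * ?y ^ (n - 1) * [:\<beta>:]" for n
    by (cases n) (simp_all add: pderiv_power_Suc pderiv_pCons of_nat_poly del: power_Suc)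
  have "0 = pderiv (\<Sum>n\<le>d. ?Q (c n) * ?y ^ n)" using c by (simp add: R_def)
  also have "\<dots> = (\<Sum>n\<le>d. pderiv (?Q (c n)) * ?y ^ n) + (\<Sum>n\<le>d. ?Q (c n) * (of_nat n * ?y ^ (n - 1) * [:\<beta>:]))"
    by (simp add: pderiv_sum pderiv_mult deriv_y sum.distrib algebra_simps)
  also have "(\<Sum>n\<le>d. ?Q (c n) * (of_nat n * ?y ^ (n - 1) * [:\<beta>:])) = D * [:\<beta>:]"
    unfolding e by (subst sum.atMost_Suc_shift)
      (simp add: D_def sum_distrib_right sum_distrib_left rat_eval_simps of_rat_poly_hom.hom_of_nat mult_ac)
  finally have rel: "(\<Sum>n\<le>d. pderiv (?Q (c n)) * ?y ^ n) + D * [:\<beta>:] = 0" by simp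
  have "finite {x. poly D x = 0}" using \<open>D \<noteq> 0\<close> by (rule poly_roots_finite)
  moreover have "infinite (range (of_nat :: nat \<Rightarrow> 'k))"
    by (subst finite_image_iff) (auto simp: inj_on_def)
  ultimately have "\<not> range (of_nat :: nat \<Rightarrow> 'k) \<subseteq> {x. poly D x = 0}" using finite_subset by blast
  then obtain m where m: "poly D (of_nat m) \<noteq> 0" by blast
  define \<gamma> where "\<gamma> = \<theta> + of_nat m * \<beta>"
  have eval_y: "poly ?y (of_nat m) = \<gamma>" by (simp add: \<gamma>_def)
  have eval_Q: "poly (?Q h) (of_nat m) \<in> rat_adjoin \<gamma>" for h
  proof -
    have "poly (?Q h) (of_rat (of_nat m)) = of_rat (poly h (of_nat m))" by (rule of_rat_hom.poly_map_poly)
    then show ?thesis by (simp add: rat_adjoin_of_rat)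
  qed
  have pow: "\<gamma> ^ n \<in> rat_adjoin \<gamma>" for n
    using rat_adjoin_of_rat[of 1 \<gamma>] by (induction n) (auto intro: rat_adjoin_mult rat_adjoin_self)
  have "poly (\<Sum>n\<le>d. pderiv (?Q (c n)) * ?y ^ n) (of_nat m) + poly D (of_nat m) * \<beta> = 0"
    using arg_cong[OF rel, of "\<lambda>g. poly g (of_nat m)"] by (simp add: mult.commute)
  moreover have "poly (\<Sum>n\<le>d. pderiv (?Q (c n)) * ?y ^ n) (of_nat m)
      = (\<Sum>n\<le>d. poly (?Q (pderiv (c n))) (of_nat m) * \<gamma> ^ n)"
    by (simp only: poly_sum poly_mult poly_power eval_y of_rat_hom.map_poly_pderiv)
  moreover have "b = - a * inverse z" if "a + z * b = 0" "z \<noteq> 0" for a b z :: 'k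
  proof -
    have "z * b = - a" using that(1) by (simp add: eq_neg_iff_add_eq_0 add.commute)
    then show ?thesis using that(2) by (simp add: field_simps)
  qed
  ultimately have \<beta>_eq:
    "\<beta> = - (\<Sum>n\<le>d. poly (?Q (pderiv (c n))) (of_nat m) * \<gamma> ^ n) * inverse (poly D (of_nat m))"
    using m by metis
  have DQ: "poly D (of_nat m) \<in> rat_adjoin \<gamma>"
    unfolding D_def poly_sum poly_mult poly_power eval_y by (intro rat_adjoin_sum rat_adjoin_mult eval_Q pow)
  have \<gamma>: "\<gamma> \<in> K" using assms number_field_of_rat[of "of_nat m"] unfolding \<gamma>_def
    by (auto intro: number_field_add number_field_mult)
  have "poly D (of_nat m) \<in> K" using DQ rat_adjoin_subset_number_field[OF \<gamma>] by blast
  then have "inverse (poly D (of_nat m)) \<in> rat_adjoin \<gamma>"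
    using inverse_in_rat_adjoin rat_adjoin_subset[OF DQ] by blast
  then have \<beta>_in: "\<beta> \<in> rat_adjoin \<gamma>" unfolding \<beta>_eq
    by (intro rat_adjoin_mult rat_adjoin_uminus rat_adjoin_sum eval_Q pow)
  have "\<theta> = \<gamma> + - (of_rat (of_nat m) * \<beta>)" by (simp add: \<gamma>_def)
  also have "\<dots> \<in> rat_adjoin \<gamma>"
    by (intro rat_adjoin_add rat_adjoin_self rat_adjoin_uminus rat_adjoin_mult rat_adjoin_of_rat \<beta>_in)
  finally have "\<theta> \<in> rat_adjoin \<gamma>" .
  then show ?thesis using \<gamma> \<beta>_in by blast
qed

theorem primitive_element: "\<exists>\<gamma>\<in>K. K = rat_adjoin \<gamma>"
proof -
  obtain S where S: "finite S" "rat_vs.span S = K" using K unfolding number_field_def by blast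
  have "\<exists>\<gamma>\<in>K. T \<subseteq> rat_adjoin \<gamma>" if "finite T" "T \<subseteq> K" for T
    using that
  proof (induction T rule: finite_induct)
    case empty
    then show ?case using number_field_of_rat[of 0] by auto
  next
    case (insert \<beta> T)
    then obtain \<theta> where \<theta>: "\<theta> \<in> K" "T \<subseteq> rat_adjoin \<theta>" by auto
    obtain \<gamma> where "\<gamma> \<in> K" "\<theta> \<in> rat_adjoin \<gamma>" "\<beta> \<in> rat_adjoin \<gamma>"
      using adjoin_two[of \<theta> \<beta>] \<theta> insert by auto
    then show ?case using \<theta> rat_adjoin_subset[of \<theta> \<gamma>] by blast
  qed
  moreover have "S \<subseteq> K" using S(2) rat_vs.span_superset by blast
  ultimately obtain \<gamma> where \<gamma>: "\<gamma> \<in> K" "S \<subseteq> rat_adjoin \<gamma>" using S(1) by blast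
  have "rat_vs.subspace (rat_adjoin \<gamma>)"
    unfolding rat_vs.subspace_def
    using rat_adjoin_of_rat[of 0 \<gamma>] by (auto intro: rat_adjoin_add rat_adjoin_mult rat_adjoin_of_rat)
  then have "K \<subseteq> rat_adjoin \<gamma>" using \<gamma>(2) S(2) rat_vs.span_minimal by blast
  then show ?thesis using \<gamma> rat_adjoin_subset_number_field by blast
qed

end

section \<open>Integral generators\<close>

lemma rat_eval_sum_monom:
  assumes "degree h < d"
  shows "rat_eval h x = (\<Sum>i<d. of_rat (coeff h i) * x ^ i)"
proof -
  have "degree (map_poly of_rat h :: 'a poly) < d" using assms by simp
  then show ?thesis
    by (subst poly_altdef, intro sum.mono_neutral_cong_left) (auto simp: coeff_eq_0)
qed

lemma common_denominator:
  fixes S :: "rat set"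
  assumes "finite S"
  shows "\<exists>m::int. m > 0 \<and> (\<forall>q\<in>S. of_int m * q \<in> \<int>)"
  using assms
proof (induction S rule: finite_induct)
  case empty
  then show ?case by (intro exI[of _ 1]) simp
next
  case (insert q S)
  then obtain m :: int where m: "m > 0" "\<And>q. q \<in> S \<Longrightarrow> of_int m * q \<in> \<int>" by blast
  obtain a b where q: "q = of_int a / of_int b" "b > 0"
    by (metis quotient_of_div quotient_of_denom_pos surj_pair)
  have "of_int (m * b) * p \<in> \<int>" if p: "p \<in> insert q S" for p
  proof (cases "p = q")
    case True
    then have "of_int (m * b) * p = of_int (m * a)" using q by simp
    then show ?thesis by (metis Ints_of_int)
  next
    case False
    then have "of_int m * p \<in> \<int>" using m(2)[of p] p by simp
    then have "of_int b * (of_int m * p) \<in> \<int>" by (rule Ints_mult[OF Ints_of_int])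
    then show ?thesis by (simp add: mult_ac)
  qed
  then show ?case using m q by (intro exI[of _ "m * b"]) auto
qed

lemma clear_denominators:
  fixes P :: "rat poly set"
  assumes "finite P"
  shows "\<exists>m::int. m > 0 \<and> (\<forall>p\<in>P. \<exists>q. of_int_poly q = smult (of_int m) p)"
proof -
  obtain m :: int where m: "m > 0" "\<And>c. c \<in> (\<Union>p\<in>P. set (coeffs p)) \<Longrightarrow> of_int m * c \<in> \<int>"
    using common_denominator[of "\<Union>p\<in>P. set (coeffs p)"] assms by auto
  have "of_int_poly (map_poly (\<lambda>c. \<lfloor>of_int m * c\<rfloor>) p) = smult (of_int m) p" if p: "p \<in> P" for p
  proof (rule poly_eqI)
    fix n
    have "of_int m * coeff p n \<in> \<int>"
    proof (cases "coeff p n = 0")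
      case False
      then have "coeff p n \<in> set (coeffs p)" using coeff_in_coeffs[of p n] le_degree[of p n] by force
      then show ?thesis using m(2) p by blast
    qed simp
    then show "coeff (of_int_poly (map_poly (\<lambda>c. \<lfloor>of_int m * c\<rfloor>) p)) n = coeff (smult (of_int m) p) n"
      by (simp add: coeff_map_poly)
  qed
  then show ?thesis using m(1) by blast
qed

text \<open>Here \<open>f\<close> is the minimal polynomial of \<open>\<theta>\<close>. The last conjunct states its minimality by degrees,
which is the form in which linear independence of the powers of \<open>\<theta>\<close> is used.\<close>

definition integral_generator :: "'k::field_char_0 set \<Rightarrow> 'k \<Rightarrow> int poly \<Rightarrow> bool" where
  "integral_generator K \<theta> f \<longleftrightarrow> K = rat_adjoin \<theta> \<and> lead_coeff f = 1 \<and> degree f = degree_nf K \<and>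
     poly (of_int_poly f) \<theta> = 0 \<and> (\<forall>h. h \<noteq> 0 \<longrightarrow> rat_eval h \<theta> = 0 \<longrightarrow> degree f \<le> degree h)"

text \<open>A primitive element \<open>\<gamma>\<close> is multiplied by a common denominator \<open>m\<close> of the
coefficients of its minimal polynomial \<open>g\<close>; the minimal polynomial of \<open>m \<gamma>\<close> has the coefficients
\<open>m ^ (d - i) * coeff g i\<close>, where \<open>d = degree g\<close>.\<close>

theorem integral_generator_exists:
  assumes K: "number_field K"
  shows "\<exists>\<theta>\<in>K. \<exists>f. integral_generator K \<theta> f"
proof -
  obtain \<gamma> where \<gamma>: "\<gamma> \<in> K" "K = rat_adjoin \<gamma>" using primitive_element[OF K] by blast
  obtain h0 where "h0 \<noteq> 0 \<and> rat_eval h0 \<gamma> = 0" using number_field_relation[OF K \<gamma>(1)] by blast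
  from ex_has_least_nat[of "\<lambda>h. h \<noteq> 0 \<and> rat_eval h \<gamma> = 0", OF this, of degree]
  obtain h where h: "h \<noteq> 0" "rat_eval h \<gamma> = 0"
    and min: "\<And>g. g \<noteq> 0 \<Longrightarrow> rat_eval g \<gamma> = 0 \<Longrightarrow> degree h \<le> degree g" by blast
  define g where "g = smult (1 / lead_coeff h) h"
  define d where "d = degree h"
  have g: "lead_coeff g = 1" "degree g = d" "rat_eval g \<gamma> = 0" "g \<noteq> 0"
    using h by (auto simp: g_def d_def rat_eval_simps)
  have indep: "c i = 0" if "(\<Sum>i<d. of_rat (c i) * \<gamma> ^ i) = 0" "i < d" for c i
  proof -
    define p where "p = (\<Sum>i<d. monom (c i) i)"
    have coeff: "coeff p i = (if i < d then c i else 0)" for i by (simp add: p_def coeff_sum)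
    have deg: "degree p < d" using that(2) by (intro degree_lessI) (auto simp: coeff)
    have "rat_eval p \<gamma> = 0" using that(1) by (subst rat_eval_sum_monom[OF deg]) (simp add: coeff)
    then have "p = 0" using min[of p] deg unfolding d_def by linarith
    then show ?thesis using coeff[of i] that(2) by simp
  qed
  have inj: "inj_on (\<lambda>i. \<gamma> ^ i) {..<d}"
  proof (rule inj_onI, rule ccontr)
    fix i j assume ij: "i \<in> {..<d}" "j \<in> {..<d}" "\<gamma> ^ i = \<gamma> ^ j" "i \<noteq> j"
    define c :: "nat \<Rightarrow> rat" where "c k = (if k = i then 1 else if k = j then - 1 else 0)" for k
    have "(\<Sum>k<d. of_rat (c k) * \<gamma> ^ k) = (\<Sum>k\<in>{i, j}. of_rat (c k) * \<gamma> ^ k)"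
      using ij by (intro sum.mono_neutral_right) (auto simp: c_def)
    also have "\<dots> = 0" using ij by (simp add: c_def of_rat_minus)
    finally show False using indep[of c i] ij by (simp add: c_def)
  qed
  let ?B = "(\<lambda>i. \<gamma> ^ i) ` {..<d}"
  have "rat_vs.independent ?B"
  proof (subst rat_vs.dependent_finite)
    show "\<nexists>u. (\<exists>v\<in>?B. u v \<noteq> 0) \<and> (\<Sum>v\<in>?B. of_rat (u v) * v) = 0"
      using indep[of "\<lambda>i. _ (\<gamma> ^ i)"] by (auto simp: sum.reindex[OF inj])
  qed simp
  moreover have "K \<subseteq> rat_vs.span ?B"
  proof
    fix x assume "x \<in> K"
    then obtain p where p: "x = rat_eval p \<gamma>" unfolding \<gamma>(2) rat_adjoin_def by blast
    have "rat_eval p \<gamma> = rat_eval (g * (p div g) + p mod g) \<gamma>" by simp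
    also have "\<dots> = rat_eval (p mod g) \<gamma>" by (simp only: rat_eval_simps poly_add poly_mult g(3)) simp
    finally have x: "x = rat_eval (p mod g) \<gamma>" using p by simp
    show "x \<in> rat_vs.span ?B"
    proof (cases "p mod g = 0")
      case True
      then show ?thesis using x by (simp add: rat_vs.span_zero)
    next
      case False
      then have "degree (p mod g) < d" using degree_mod_less[of g p] g by auto
      then show ?thesis unfolding x
        by (subst rat_eval_sum_monom, assumption) (intro rat_vs.span_sum rat_vs.span_scale rat_vs.span_base imageI)
    qed
  qed
  moreover have "?B \<subseteq> K" using number_field_power[OF K \<gamma>(1)] by blast
  ultimately have "card ?B = rat_vs.dim K" by (intro rat_vs.basis_card_eq_dim)
  then have dim: "degree_nf K = d" unfolding degree_nf_def using card_image[OF inj] by simp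
  obtain m z0 where m: "m > 0" and z0: "of_int_poly z0 = smult (of_int m) g"
    using clear_denominators[of "{g}"] by auto
  define z where "z i = coeff z0 i" for i
  have z: "of_int (z i) = of_int m * coeff g i" for i
    using arg_cong[OF z0, of "\<lambda>p. coeff p i"] by (simp add: z_def)
  define \<theta> where "\<theta> = of_int m * \<gamma>"
  define f0 where "f0 = (\<Sum>i<d. monom (z i * m ^ (d - 1 - i)) i)"
  define f where "f = monom 1 d + f0"
  have f0: "coeff f0 i = (if i < d then z i * m ^ (d - 1 - i) else 0)" for i
    by (simp add: f0_def coeff_sum)
  have coeff_f: "coeff f i = (if i = d then 1 else if i < d then z i * m ^ (d - 1 - i) else 0)" for i
    by (simp add: f_def f0)
  have deg: "degree f = d"
    by (intro antisym degree_le le_degree) (auto simp: coeff_f)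
  have eval: "poly (of_int_poly p) x = (\<Sum>i\<le>degree p. of_int (coeff p i) * x ^ i)" for p :: "int poly" and x :: 'a
    by (simp add: poly_altdef)
  have "poly (of_int_poly f) \<theta> = of_int m ^ d * rat_eval g \<gamma>"
  proof -
    have "poly (of_int_poly f) \<theta> = \<theta> ^ d + (\<Sum>i<d. of_int (z i * m ^ (d - 1 - i)) * \<theta> ^ i)"
      unfolding eval deg by (simp add: coeff_f lessThan_Suc_atMost[symmetric])
    also have "(\<Sum>i<d. of_int (z i * m ^ (d - 1 - i)) * \<theta> ^ i) = (\<Sum>i<d. of_int m ^ d * (of_rat (coeff g i) * \<gamma> ^ i))"
    proof (intro sum.cong refl)
      fix i assume "i \<in> {..<d}"
      then have d: "d = Suc (d - 1 - i + i)" by auto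
      have "(of_int (z i) :: 'a) = of_rat (of_int (z i))" by simp
      also have "\<dots> = of_int m * of_rat (coeff g i)" unfolding z of_rat_mult by simp
      finally have zi: "(of_int (z i) :: 'a) = of_int m * of_rat (coeff g i)" .
      have "(of_int m :: 'a) ^ d = of_int m * of_int m ^ (d - 1 - i) * of_int m ^ i"
        by (subst d) (simp add: power_add)
      then show "of_int (z i * m ^ (d - 1 - i)) * \<theta> ^ i = of_int m ^ d * (of_rat (coeff g i) * \<gamma> ^ i)"
        unfolding \<theta>_def by (simp add: zi power_mult_distrib mult_ac)
    qed
    also have "\<theta> ^ d + \<dots> = of_int m ^ d * (\<Sum>i\<le>d. of_rat (coeff g i) * \<gamma> ^ i)"
      using g(1,2) by (simp add: \<theta>_def power_mult_distrib sum_distrib_left lessThan_Suc_atMost[symmetric] distrib_left)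
    also have "(\<Sum>i\<le>d. of_rat (coeff g i) * \<gamma> ^ i) = rat_eval g \<gamma>" using g(2) by (simp add: poly_altdef)
    finally show ?thesis .
  qed
  then have root: "poly (of_int_poly f) \<theta> = 0" using g(3) by simp
  have \<theta>K: "\<theta> \<in> K" unfolding \<theta>_def
    using number_field_mult[OF K number_field_of_rat[OF K, of "of_int m"] \<gamma>(1)] by simp
  have "of_rat (1 / of_int m) * \<theta> \<in> rat_adjoin \<theta>" by (intro rat_adjoin_mult rat_adjoin_of_rat rat_adjoin_self)
  moreover have "of_rat (1 / of_int m) * \<theta> = \<gamma>" using m by (simp add: \<theta>_def of_rat_divide)
  ultimately have "\<gamma> \<in> rat_adjoin \<theta>" by simp
  then have adj: "K = rat_adjoin \<theta>"
    using rat_adjoin_subset[of \<gamma> \<theta>] rat_adjoin_subset_number_field[OF K \<theta>K] \<gamma>(2) by blast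
  have "degree f \<le> degree p" if "p \<noteq> 0" "rat_eval p \<theta> = 0" for p
  proof -
    define q where "q = pcompose p [:0, of_int m:]"
    have "rat_eval q \<gamma> = 0" using that(2)
      by (simp add: q_def of_rat_hom.map_poly_pcompose poly_pcompose \<theta>_def rat_eval_simps mult.commute)
    moreover have "degree q = degree p" using m by (simp add: q_def)
    moreover have "q \<noteq> 0" using that(1) m(1) by (simp add: q_def pcompose_eq_0_iff)
    ultimately show ?thesis using min[of q] deg by (simp add: d_def)
  qed
  then have "integral_generator K \<theta> f" unfolding integral_generator_def
    using adj deg dim root by (auto simp: coeff_f)
  then show ?thesis using \<theta>K by blast
qed

text \<open>By minimality the derivative of \<open>f\<close> does not vanish at \<open>\<theta>\<close>, so it has an inverse
\<open>v(\<theta>)\<close> and \<open>f\<close> divides \<open>v * pderiv f - 1\<close>. The integer \<open>D\<close> appears when denominators are cleared.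
Modulo primes not dividing \<open>D\<close>, all roots of \<open>f\<close> are simple.\<close>

lemma integral_generator_separable:
  assumes K: "number_field K" and gen: "integral_generator K \<theta> f" and deg: "degree f \<ge> 1"
  shows "\<exists>u v D. u * f + v * pderiv f = [:D:] \<and> D \<noteq> 0"
proof -
  let ?f = "of_int_poly f :: rat poly"
  have eval: "rat_eval (of_int_poly p) \<theta> = poly (of_int_poly p) \<theta>" for p :: "int poly"
    by (simp add: map_poly_map_poly o_def)
  have f: "rat_eval ?f \<theta> = 0" "lead_coeff f = 1"
    using gen unfolding integral_generator_def by (auto simp: eval)
  have min: "\<And>h. h \<noteq> 0 \<Longrightarrow> rat_eval h \<theta> = 0 \<Longrightarrow> degree f \<le> degree h"
    using gen unfolding integral_generator_def by blast
  have \<theta>: "\<theta> \<in> K" using gen rat_adjoin_self unfolding integral_generator_def by blast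
  let ?y = "rat_eval (pderiv ?f) \<theta>"
  have "pderiv ?f \<noteq> 0" using deg by (auto simp: pderiv_eq_0_iff)
  moreover have "degree (pderiv ?f) < degree f" using deg by (simp add: degree_pderiv)
  ultimately have y: "?y \<noteq> 0" using min[of "pderiv ?f"] by linarith
  have "?y \<in> rat_adjoin \<theta>" unfolding rat_adjoin_def by blast
  then have "inverse ?y \<in> rat_adjoin \<theta>"
    using inverse_in_rat_adjoin[OF K] rat_adjoin_subset gen unfolding integral_generator_def by blast
  then obtain v where v: "inverse ?y = rat_eval v \<theta>" unfolding rat_adjoin_def by blast
  have "rat_eval (v * pderiv ?f - 1) \<theta> = 0"
    using y v[symmetric] by (simp add: of_rat_poly_hom.hom_minus rat_eval_simps)
  moreover have "?f dvd w" if "rat_eval w \<theta> = 0" for w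
  proof (rule ccontr)
    assume "\<not> ?f dvd w"
    then have nz: "w mod ?f \<noteq> 0" by (simp add: dvd_eq_mod_eq_0)
    have "rat_eval w \<theta> = rat_eval (?f * (w div ?f) + w mod ?f) \<theta>" by simp
    also have "\<dots> = rat_eval (w mod ?f) \<theta>" by (simp only: rat_eval_simps poly_add poly_mult f) simp
    finally have "rat_eval (w mod ?f) \<theta> = 0" using that by simp
    from min[OF nz this] degree_mod_less[of ?f w] nz show False using f(2) by force
  qed
  ultimately have "?f dvd v * pderiv ?f - 1" by blast
  then obtain u where u: "v * pderiv ?f - 1 = ?f * u" by (elim dvdE)
  obtain m U V where m: "m > 0" and U: "of_int_poly U = smult (of_int m) (- u)"
    and V: "of_int_poly V = smult (of_int m) v"
    using clear_denominators[of "{- u, v}"] by auto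
  have "of_int_poly (U * f + V * pderiv f) = (smult (of_int m) (v * pderiv ?f - ?f * u) :: rat poly)"
    by (simp add: of_int_poly_hom.hom_add of_int_poly_hom.hom_mult U V of_int_hom.map_poly_pderiv
        smult_diff_right mult.commute)
  also have "v * pderiv ?f - ?f * u = 1" using u by (simp add: algebra_simps)
  also have "smult (of_int m) 1 = (of_int_poly [:m:] :: rat poly)"
    by (simp add: of_int_hom.map_poly_pCons_hom)
  finally have "U * f + V * pderiv f = [:m:]" by (simp only: of_int_poly_hom.injectivity)
  then show ?thesis using m by (intro exI[of _ U] exI[of _ V] exI[of _ m]) auto
qed

section \<open>Norms as determinants in a power basis\<close>

text \<open>As \<open>v 0 = 1\<close>, replacing the first row by the combination of all rows with coefficients \<open>v\<close>
leaves the determinant unchanged, whatever the ring.\<close>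

lemma dvd_det_of_dvd_row_combination:
  fixes A :: "'a::comm_ring_1 mat"
  assumes A: "A \<in> carrier_mat n n" and n: "n > 0" and v: "v 0 = 1"
    and dvd: "\<And>j. j < n \<Longrightarrow> m dvd (\<Sum>i<n. v i * A $$ (i, j))"
  shows "m dvd det A"
proof -
  define E where "E = mat n n (\<lambda>(i, j). if i = 0 then v j else if i = j then 1 else (0 :: 'a))"
  have E: "E \<in> carrier_mat n n" by (simp add: E_def)
  have "upper_triangular E" by (rule upper_triangularI) (auto simp: E_def)
  then have "det E = prod_list (diag_mat E)" using E by (rule det_upper_triangular)
  also have "diag_mat E = map (\<lambda>_. 1) [0..<n]"
    unfolding diag_mat_def using v by (auto simp: E_def)
  also have "prod_list \<dots> = 1" by (induction n) auto
  finally have detE: "det E = 1" .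
  have EA: "E * A \<in> carrier_mat n n" using E A by simp
  have entry: "(E * A) $$ (0, j) = (\<Sum>i<n. v i * A $$ (i, j))" if "j < n" for j
    using A n that by (auto simp: E_def scalar_prod_def lessThan_atLeast0 intro!: sum.cong)
  have "det A = det (E * A)" using det_mult[OF E A] detE by simp
  also have "\<dots> = (\<Sum>j<n. (E * A) $$ (0, j) * cofactor (E * A) 0 j)"
    by (rule laplace_expansion_row[OF EA n])
  also have "m dvd \<dots>" by (intro dvd_sum dvd_mult2) (use entry dvd in auto)
  finally show ?thesis .
qed

lemma abs_det_le:
  fixes A :: "'a::linordered_idom mat"
  assumes A: "A \<in> carrier_mat n n" and E: "\<And>i j. i < n \<Longrightarrow> j < n \<Longrightarrow> \<bar>A $$ (i, j)\<bar> \<le> E"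
  shows "\<bar>det A\<bar> \<le> fact n * E ^ n"
proof -
  let ?P = "{p. p permutes {0..<n}}"
  have "\<bar>det A\<bar> \<le> (\<Sum>p\<in>?P. \<bar>signof p * (\<Prod>i = 0..<n. A $$ (i, p i))\<bar>)"
    unfolding det_def'[OF A] by (rule sum_abs)
  also have "\<dots> \<le> (\<Sum>p\<in>?P. E ^ n)"
  proof (intro sum_mono)
    fix p assume p: "p \<in> ?P"
    have "\<bar>signof p * (\<Prod>i = 0..<n. A $$ (i, p i))\<bar> = (\<Prod>i = 0..<n. \<bar>A $$ (i, p i)\<bar>)"
      by (simp add: abs_mult abs_prod sign_def)
    also have "\<dots> \<le> (\<Prod>i = 0..<n. E)"
    proof (intro prod_mono conjI)
      fix i assume i: "i \<in> {0..<n}"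
      then have "p i < n" using p permutes_in_image[of p "{0..<n}" i] by auto
      then show "\<bar>A $$ (i, p i)\<bar> \<le> E" using E i by auto
    qed auto
    finally show "\<bar>signof p * (\<Prod>i = 0..<n. A $$ (i, p i))\<bar> \<le> E ^ n" by simp
  qed
  also have "\<dots> = fact n * E ^ n" by (simp add: card_permutations)
  finally show ?thesis .
qed

context
  fixes K :: "'k::field_char_0 set" and bs :: "'k list" and r :: nat
  assumes K: "number_field K" and bs: "rat_basis K bs" and r: "length bs = r"
begin

lemma basis_unique:
  assumes eq: "(\<Sum>i<r. of_rat (c i) * bs ! i) = (\<Sum>i<r. of_rat (d i) * bs ! i)" and i: "i < r"
  shows "c i = d i"
proof (rule ccontr)
  assume neq: "c i \<noteq> d i"
  have dist: "distinct bs" and ind: "rat_vs.independent (set bs)" using bs by (auto simp: rat_basis_def)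
  have bij: "bij_betw (\<lambda>i. bs ! i) {..<r} (set bs)" using bij_betw_nth[OF dist] r by auto
  define u where "u v = (let k = the_inv_into {..<r} (\<lambda>i. bs ! i) v in c k - d k)" for v
  have u: "u (bs ! k) = c k - d k" if "k < r" for k
  proof -
    have "the_inv_into {..<r} (\<lambda>i. bs ! i) (bs ! k) = k"
      using that bij by (intro the_inv_into_f_f) (auto simp: bij_betw_def)
    then show ?thesis by (simp add: u_def)
  qed
  have "(\<Sum>v\<in>set bs. of_rat (u v) * v) = (\<Sum>k<r. of_rat (u (bs ! k)) * bs ! k)"
    using sum.reindex_bij_betw[OF bij, of "\<lambda>v. of_rat (u v) * v"] by simp
  also have "\<dots> = (\<Sum>k<r. of_rat (c k) * bs ! k - of_rat (d k) * bs ! k)"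
    by (intro sum.cong) (auto simp: u of_rat_diff left_diff_distrib)
  also have "\<dots> = 0" using eq by (simp add: sum_subtractf)
  finally have "(\<Sum>v\<in>set bs. of_rat (u v) * v) = 0" .
  moreover have "u (bs ! i) \<noteq> 0" "bs ! i \<in> set bs" using u i neq r by auto
  ultimately have "rat_vs.dependent (set bs)" by (subst rat_vs.dependent_finite) auto
  then show False using ind by simp
qed

lemma basis_expansion:
  assumes "x \<in> K"
  shows "x = (\<Sum>i<r. of_rat (rat_vs.representation (set bs) x (bs ! i)) * bs ! i)"
proof -
  have dist: "distinct bs" and ind: "rat_vs.independent (set bs)" and sp: "rat_vs.span (set bs) = K"
    using bs by (auto simp: rat_basis_def)
  have bij: "bij_betw (\<lambda>i. bs ! i) {..<r} (set bs)" using bij_betw_nth[OF dist] r by auto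
  have "(\<Sum>b\<in>set bs. of_rat (rat_vs.representation (set bs) x b) * b) = x"
    using assms sp by (intro rat_vs.sum_representation_eq[OF ind]) auto
  then show ?thesis
    using sum.reindex_bij_betw[OF bij, of "\<lambda>b. of_rat (rat_vs.representation (set bs) x b) * b"] by simp
qed

lemma basis_nth_in: "i < r \<Longrightarrow> bs ! i \<in> K"
  using bs r rat_vs.span_base[of "bs ! i" "set bs"] by (auto simp: rat_basis_def)

lemma mult_matrix_entry:
  assumes "i < r" "j < r"
  shows "mult_matrix bs x $$ (i, j) = rat_vs.representation (set bs) (x * bs ! j) (bs ! i)"
  using assms r by (simp add: mult_matrix_def)

lemma mult_matrix_carrier: "mult_matrix bs x \<in> carrier_mat r r"
  using r by (simp add: mult_matrix_def)

lemma mult_matrix_of_rat_mult: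
  assumes "x \<in> K"
  shows "mult_matrix bs (of_rat q * x) = q \<cdot>\<^sub>m mult_matrix bs x"
proof (rule eq_matI)
  fix i j assume "i < dim_row (q \<cdot>\<^sub>m mult_matrix bs x)" "j < dim_col (q \<cdot>\<^sub>m mult_matrix bs x)"
  then have ij: "i < r" "j < r" using mult_matrix_carrier[of x] by auto
  have "x * bs ! j \<in> rat_vs.span (set bs)"
    using number_field_mult[OF K assms basis_nth_in[OF ij(2)]] bs by (simp add: rat_basis_def)
  then have "rat_vs.representation (set bs) (of_rat q * (x * bs ! j)) (bs ! i)
      = q * rat_vs.representation (set bs) (x * bs ! j) (bs ! i)"
    using bs by (subst rat_vs.representation_scale) (auto simp: rat_basis_def)
  then show "mult_matrix bs (of_rat q * x) $$ (i, j) = (q \<cdot>\<^sub>m mult_matrix bs x) $$ (i, j)"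
    using ij mult_matrix_carrier[of x] by (simp add: mult_matrix_entry mult.assoc)
qed (simp_all add: mult_matrix_def)

lemma mult_matrix_sum_entry:
  assumes x: "\<And>k. k \<in> I \<Longrightarrow> x k \<in> K" and ij: "i < r" "j < r"
  shows "mult_matrix bs (\<Sum>k\<in>I. of_rat (q k) * x k) $$ (i, j) = (\<Sum>k\<in>I. q k * mult_matrix bs (x k) $$ (i, j))"
proof -
  have ind: "rat_vs.independent (set bs)" and sp: "rat_vs.span (set bs) = K" using bs by (auto simp: rat_basis_def)
  have span: "x k * bs ! j \<in> rat_vs.span (set bs)" if "k \<in> I" for k
    unfolding sp using number_field_mult[OF K x[OF that] basis_nth_in[OF ij(2)]] .
  have "rat_vs.representation (set bs) (\<Sum>k\<in>I. of_rat (q k) * (x k * bs ! j))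
      = (\<lambda>b. \<Sum>k\<in>I. rat_vs.representation (set bs) (of_rat (q k) * (x k * bs ! j)) b)"
    using span by (intro rat_vs.representation_sum[OF ind] rat_vs.span_scale)
  also have "\<dots> = (\<lambda>b. \<Sum>k\<in>I. q k * rat_vs.representation (set bs) (x k * bs ! j) b)"
    using span by (intro ext sum.cong refl) (simp add: rat_vs.representation_scale[OF ind])
  finally show ?thesis using ij by (simp add: mult_matrix_entry sum_distrib_right mult.assoc)
qed

text \<open>Change of basis from \<open>bs\<close> to the powers of \<open>\<theta>\<close>. The power basis is the one in which divisibility
of norms can be read off, whereas the norm is defined by an unspecified basis.\<close>

lemma det_mult_matrix_eq:
  assumes x: "x \<in> K" and \<theta>: "\<theta> \<in> K" and M': "M' \<in> carrier_mat r r"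
    and basis: "\<And>y. y \<in> K \<Longrightarrow> \<exists>t. y = (\<Sum>i<r. of_rat (t i) * \<theta> ^ i)"
    and act: "\<And>j. j < r \<Longrightarrow> x * \<theta> ^ j = (\<Sum>i<r. of_rat (M' $$ (i, j)) * \<theta> ^ i)"
  shows "det (mult_matrix bs x) = det M'"
proof -
  let ?M = "mult_matrix bs x"
  let ?rep = "\<lambda>y i. rat_vs.representation (set bs) y (bs ! i)"
  define S where "S = mat r r (\<lambda>(i, j). ?rep (\<theta> ^ j) i)"
  have S: "S \<in> carrier_mat r r" by (simp add: S_def)
  have M: "?M \<in> carrier_mat r r" by (rule mult_matrix_carrier)
  have power: "\<theta> ^ j = (\<Sum>i<r. of_rat (S $$ (i, j)) * bs ! i)" if "j < r" for j
    using basis_expansion[OF number_field_power[OF K \<theta>, of j]] that by (simp add: S_def)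
  have entry: "(A * B) $$ (i, j) = (\<Sum>k<r. A $$ (i, k) * B $$ (k, j))"
    if "A \<in> carrier_mat r r" "B \<in> carrier_mat r r" "i < r" "j < r" for A B :: "rat mat" and i j
    using that by (auto simp: scalar_prod_def lessThan_atLeast0 intro!: sum.cong)
  have MS: "?M * S = S * M'"
  proof (rule eq_matI)
    fix i j assume "i < dim_row (S * M')" "j < dim_col (S * M')"
    then have ij: "i < r" "j < r" using S M' by auto
    have "(\<Sum>i<r. of_rat (\<Sum>k<r. ?M $$ (i, k) * S $$ (k, j)) * bs ! i)
        = (\<Sum>k<r. of_rat (S $$ (k, j)) * (\<Sum>i<r. of_rat (?M $$ (i, k)) * bs ! i))"
      unfolding of_rat_sum sum_distrib_left sum_distrib_right
      by (subst sum.swap) (simp add: of_rat_mult mult_ac)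
    also have "\<dots> = (\<Sum>k<r. of_rat (S $$ (k, j)) * (x * bs ! k))"
    proof (intro sum.cong refl arg_cong2[of _ _ _ _ "(*)"])
      fix k assume "k \<in> {..<r}"
      then have k: "k < r" by simp
      then show "(\<Sum>i<r. of_rat (?M $$ (i, k)) * bs ! i) = x * bs ! k"
        using basis_expansion[OF number_field_mult[OF K x basis_nth_in[OF k]]] by (simp add: mult_matrix_entry)
    qed
    also have "\<dots> = x * \<theta> ^ j" using power[OF ij(2)] by (simp add: sum_distrib_left mult_ac)
    also have "\<dots> = (\<Sum>k<r. of_rat (M' $$ (k, j)) * (\<Sum>i<r. of_rat (S $$ (i, k)) * bs ! i))"
      using act[OF ij(2)] power by simp
    also have "\<dots> = (\<Sum>i<r. of_rat (\<Sum>k<r. S $$ (i, k) * M' $$ (k, j)) * bs ! i)"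
      unfolding of_rat_sum sum_distrib_left sum_distrib_right
      by (subst sum.swap) (simp add: of_rat_mult mult_ac)
    finally have eq: "(\<Sum>i<r. of_rat (\<Sum>k<r. ?M $$ (i, k) * S $$ (k, j)) * bs ! i)
        = (\<Sum>i<r. of_rat (\<Sum>k<r. S $$ (i, k) * M' $$ (k, j)) * bs ! i)" .
    from basis_unique[OF this ij(1)] show "(?M * S) $$ (i, j) = (S * M') $$ (i, j)" using ij S M M' by (simp only: entry)
  qed (use S M M' in auto)
  have "\<forall>j. \<exists>t. j < r \<longrightarrow> bs ! j = (\<Sum>i<r. of_rat (t i) * \<theta> ^ i)" using basis basis_nth_in by blast
  then obtain t where t: "\<And>j. j < r \<Longrightarrow> bs ! j = (\<Sum>i<r. of_rat (t j i) * \<theta> ^ i)" by metis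
  define T where "T = mat r r (\<lambda>(i, j). t j i)"
  have T: "T \<in> carrier_mat r r" by (simp add: T_def)
  have "S * T = 1\<^sub>m r"
  proof (rule eq_matI)
    fix i j assume "i < dim_row (1\<^sub>m r :: rat mat)" "j < dim_col (1\<^sub>m r :: rat mat)"
    then have ij: "i < r" "j < r" by auto
    have "(\<Sum>i<r. of_rat (\<Sum>k<r. S $$ (i, k) * T $$ (k, j)) * bs ! i)
        = (\<Sum>k<r. of_rat (T $$ (k, j)) * (\<Sum>i<r. of_rat (S $$ (i, k)) * bs ! i))"
      unfolding of_rat_sum sum_distrib_left sum_distrib_right
      by (subst sum.swap) (simp add: of_rat_mult mult_ac)
    also have "\<dots> = bs ! j" using t[OF ij(2)] power ij by (simp add: T_def)
    also have "\<dots> = (\<Sum>i<r. of_rat (if i = j then 1 else 0) * bs ! i)"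
      using ij by (simp add: if_distrib[of of_rat] if_distrib[of "\<lambda>a. a * _"] cong: if_cong)
    finally have eq: "(\<Sum>i<r. of_rat (\<Sum>k<r. S $$ (i, k) * T $$ (k, j)) * bs ! i)
        = (\<Sum>i<r. of_rat (if i = j then 1 else 0) * bs ! i)" .
    from basis_unique[OF this ij(1)] show "(S * T) $$ (i, j) = 1\<^sub>m r $$ (i, j)" using ij by (simp add: entry[OF S T])
  qed (use S T in auto)
  then have "det S * det T = 1" using det_mult[OF S T] by simp
  then have "det S \<noteq> 0" by auto
  moreover have "det ?M * det S = det M' * det S"
    unfolding det_mult[OF M S, symmetric] MS det_mult[OF S M'] by (rule mult.commute)
  ultimately show ?thesis by simp
qed

end

abbreviation int_eval :: "int poly \<Rightarrow> 'k::field_char_0 \<Rightarrow> 'k" where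
  "int_eval h x \<equiv> poly (of_int_poly h) x"

lemma rat_eval_of_int_poly: "rat_eval (of_int_poly p) x = int_eval p x"
  by (simp add: map_poly_map_poly o_def)

context
  fixes K :: "'k::field_char_0 set"
  assumes K: "number_field K"
begin

lemma rat_basis_some: "rat_basis K (SOME bs. rat_basis K bs)" "length (SOME bs. rat_basis K bs) = degree_nf K"
proof -
  obtain S where S: "finite S" "rat_vs.span S = K" using K unfolding number_field_def by blast
  obtain B where B: "B \<subseteq> K" "rat_vs.independent B" "K \<subseteq> rat_vs.span B"
    using rat_vs.basis_exists[of K] by metis
  have "finite B" using rat_vs.independent_span_bound[OF S(1) B(2)] B(1) S(2) by simp
  then obtain bs where bs: "set bs = B" "distinct bs" using finite_distinct_list by blast
  have "rat_vs.span B = K"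
    using B rat_vs.span_minimal[OF B(1) number_field_subspace[OF K]] by blast
  then have "rat_basis K bs" using bs B by (simp add: rat_basis_def)
  then show *: "rat_basis K (SOME bs. rat_basis K bs)" by (rule someI)
  have len: "length cs = degree_nf K" if "rat_basis K cs" for cs
  proof -
    have cs: "distinct cs" "rat_vs.independent (set cs)" "rat_vs.span (set cs) = K"
      using that by (auto simp: rat_basis_def)
    have "rat_vs.dim (rat_vs.span (set cs)) = card (set cs)"
      by (rule rat_vs.dim_span_eq_card_independent[OF cs(2)])
    then show ?thesis using cs(1) unfolding degree_nf_def cs(3) by (simp add: distinct_card)
  qed
  show "length (SOME bs. rat_basis K bs) = degree_nf K" by (rule len[OF *])
qed

lemma field_norm_of_rat_mult:
  assumes "x \<in> K"
  shows "field_norm K (of_rat q * x) = q ^ degree_nf K * field_norm K x"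
  using mult_matrix_of_rat_mult[OF K rat_basis_some assms, of q]
    mult_matrix_carrier[OF K rat_basis_some, of x]
  by (simp add: field_norm_def det_smult)

text \<open>The entries of the multiplication matrix are linear in \<open>d\<close>.\<close>

lemma abs_field_norm_linear_le:
  fixes x :: "'i \<Rightarrow> 'k"
  assumes "finite I" and x: "\<And>k. k \<in> I \<Longrightarrow> x k \<in> K"
  shows "\<exists>C>0. \<forall>d N. N \<ge> 0 \<longrightarrow> (\<forall>k\<in>I. \<bar>d k\<bar> \<le> N) \<longrightarrow>
    \<bar>field_norm K (\<Sum>k\<in>I. of_rat (d k) * x k)\<bar> \<le> C * N ^ degree_nf K"
proof -
  define bs where "bs = (SOME bs. rat_basis K bs)"
  define r where "r = degree_nf K"
  have bs: "rat_basis K bs" "length bs = r" using rat_basis_some by (simp_all add: bs_def r_def)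
  let ?m = "\<lambda>k. mult_matrix bs (x k)"
  define E where "E = (\<Sum>k\<in>I. \<Sum>i<r. \<Sum>j<r. \<bar>?m k $$ (i, j)\<bar>)"
  have E: "E \<ge> 0" unfolding E_def by (intro sum_nonneg) auto
  have "\<bar>field_norm K (\<Sum>k\<in>I. of_rat (d k) * x k)\<bar> \<le> (fact r * E ^ r + 1) * N ^ r"
    if d: "\<forall>k\<in>I. \<bar>d k\<bar> \<le> N" and N: "N \<ge> 0" for d N
  proof -
    let ?M = "mult_matrix bs (\<Sum>k\<in>I. of_rat (d k) * x k)"
    have "\<bar>?M $$ (i, j)\<bar> \<le> E * N" if ij: "i < r" "j < r" for i j
    proof -
      have "?M $$ (i, j) = (\<Sum>k\<in>I. d k * ?m k $$ (i, j))"
        by (rule mult_matrix_sum_entry[OF K bs x ij])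
      also have "\<bar>\<dots>\<bar> \<le> (\<Sum>k\<in>I. \<bar>d k * ?m k $$ (i, j)\<bar>)" by (rule sum_abs)
      also have "\<dots> \<le> (\<Sum>k\<in>I. N * (\<Sum>i<r. \<Sum>j<r. \<bar>?m k $$ (i, j)\<bar>))"
      proof (intro sum_mono)
        fix k assume k: "k \<in> I"
        have "\<bar>?m k $$ (i, j)\<bar> \<le> (\<Sum>j<r. \<bar>?m k $$ (i, j)\<bar>)"
          using ij by (intro member_le_sum) auto
        also have "\<dots> \<le> (\<Sum>i<r. \<Sum>j<r. \<bar>?m k $$ (i, j)\<bar>)"
          using ij by (intro member_le_sum[of i "{..<r}" "\<lambda>i. \<Sum>j<r. \<bar>?m k $$ (i, j)\<bar>"]) (auto intro: sum_nonneg)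
        finally show "\<bar>d k * ?m k $$ (i, j)\<bar> \<le> N * (\<Sum>i<r. \<Sum>j<r. \<bar>?m k $$ (i, j)\<bar>)"
          unfolding abs_mult using d k N by (intro mult_mono) auto
      qed
      also have "\<dots> = E * N" unfolding E_def sum_distrib_left[symmetric] by (rule mult.commute)
      finally show ?thesis .
    qed
    then have "\<bar>det ?M\<bar> \<le> fact r * (E * N) ^ r"
      by (intro abs_det_le mult_matrix_carrier[OF K bs])
    also have "\<dots> \<le> (fact r * E ^ r + 1) * N ^ r" using N by (simp add: power_mult_distrib algebra_simps)
    finally show ?thesis by (simp add: field_norm_def bs_def)
  qed
  moreover have "fact r * E ^ r + 1 > 0" using E by (intro add_nonneg_pos) auto
  ultimately show ?thesis unfolding r_def by blast
qed

context
  fixes \<theta> :: 'k and f :: "int poly" and r :: nat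
  assumes gen: "integral_generator K \<theta> f" and deg_r: "degree_nf K = r" and r_pos: "r \<ge> 1"
begin

lemma generator_in: "\<theta> \<in> K"
  using gen rat_adjoin_self unfolding integral_generator_def by blast

lemma power_basis_span:
  assumes "y \<in> K"
  shows "\<exists>t. y = (\<Sum>i<r. of_rat (t i) * \<theta> ^ i)"
proof -
  let ?f = "of_int_poly f :: rat poly"
  have f: "rat_eval ?f \<theta> = 0" "degree ?f = r"
    using gen deg_r unfolding integral_generator_def rat_eval_of_int_poly by auto
  obtain p where p: "y = rat_eval p \<theta>"
    using assms gen unfolding integral_generator_def rat_adjoin_def by blast
  have "rat_eval p \<theta> = rat_eval (?f * (p div ?f) + p mod ?f) \<theta>" by simp
  also have "\<dots> = rat_eval (p mod ?f) \<theta>" by (simp only: rat_eval_simps poly_add poly_mult f) simp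
  finally have y: "y = rat_eval (p mod ?f) \<theta>" using p by simp
  have "degree (p mod ?f) < r"
  proof (cases "p mod ?f = 0")
    case False
    have "?f \<noteq> 0" using f(2) r_pos by force
    then show ?thesis using degree_mod_less[of ?f p] False f(2) by simp
  qed (use r_pos in simp)
  from rat_eval_sum_monom[OF this, of \<theta>] y show ?thesis by metis
qed

text \<open>Reducing \<open>h * X ^ j\<close> modulo the monic polynomial \<open>f\<close> gives column \<open>j\<close> of the
matrix of multiplication by \<open>h(\<theta>)\<close>, with integer entries. Evaluation at \<open>a\<close> turns this reduction into a congruence
modulo \<open>m\<close>, so the combination of the rows with coefficients \<open>a ^ i\<close> has entries congruent to
\<open>poly h a * a ^ j\<close>, that is, to \<open>0\<close>.\<close>

lemma field_norm_int_eval_dvd: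
  assumes fa: "m dvd poly f a" and ha: "m dvd poly h a"
  shows "\<exists>n. field_norm K (int_eval h \<theta>) = of_int n \<and> m dvd n"
proof -
  have f: "lead_coeff f = 1" "degree f = r" "int_eval f \<theta> = 0" "f \<noteq> 0"
    using gen deg_r unfolding integral_generator_def by auto
  have "\<exists>q t. h * monom 1 j = f * q + t \<and> degree t < r" for j
  proof -
    obtain q t where qt: "pseudo_divmod (h * monom 1 j) f = (q, t)" by fastforce
    from pseudo_divmod[OF f(4) qt] f have "h * monom 1 j = f * q + t" "t = 0 \<or> degree t < r" by auto
    then show ?thesis using r_pos by (intro exI[of _ q] exI[of _ t]) auto
  qed
  then obtain q t where qt: "\<And>j. h * monom 1 j = f * q j + t j" "\<And>j. degree (t j) < r" by metis
  define A where "A = mat r r (\<lambda>(i, j). coeff (t j) i)"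
  have A: "A \<in> carrier_mat r r" by (simp add: A_def)
  have eval_t: "poly (map_poly g (t j)) y = (\<Sum>i<r. g (coeff (t j) i) * y ^ i)"
    if "g 0 = 0" for g :: "int \<Rightarrow> 'b::comm_semiring_1" and y j
  proof -
    have "degree (map_poly g (t j)) < r" using degree_map_poly_le[of g "t j"] qt(2)[of j] by linarith
    then have "poly (map_poly g (t j)) y = (\<Sum>i<r. coeff (map_poly g (t j)) i * y ^ i)"
      unfolding poly_altdef by (intro sum.mono_neutral_left) (auto simp: coeff_eq_0)
    then show ?thesis using that by (simp add: coeff_map_poly)
  qed
  have "field_norm K (int_eval h \<theta>) = det (map_mat of_int A)"
    unfolding field_norm_def
  proof (rule det_mult_matrix_eq[OF K rat_basis_some(1) _ _ generator_in _ power_basis_span])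
    show "length (SOME bs. rat_basis K bs) = r" using rat_basis_some(2) deg_r by simp
    show "int_eval h \<theta> \<in> K"
      using rat_adjoin_subset_number_field[OF K generator_in] rat_eval_of_int_poly[of h \<theta>]
      unfolding rat_adjoin_def by (metis rangeI subset_iff)
    show "map_mat of_int A \<in> carrier_mat r r" using A by simp
    fix j assume j: "j < r"
    have "int_eval h \<theta> * \<theta> ^ j = int_eval (h * monom 1 j) \<theta>"
      by (simp add: of_int_poly_hom.hom_mult poly_monom)
    also have "\<dots> = int_eval (t j) \<theta>"
      unfolding qt(1) by (simp add: of_int_poly_hom.hom_add of_int_poly_hom.hom_mult f)
    also have "\<dots> = (\<Sum>i<r. of_rat (map_mat of_int A $$ (i, j)) * \<theta> ^ i)"
      using j by (subst eval_t) (auto simp: A_def)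
    finally show "int_eval h \<theta> * \<theta> ^ j = (\<Sum>i<r. of_rat (map_mat of_int A $$ (i, j)) * \<theta> ^ i)" .
  qed
  also have "\<dots> = of_int (det A)" by (rule of_int_hom.hom_det)
  finally have norm: "field_norm K (int_eval h \<theta>) = of_int (det A)" .
  have "m dvd det A"
  proof (rule dvd_det_of_dvd_row_combination[OF A, of "\<lambda>i. a ^ i"])
    fix j assume j: "j < r"
    have "(\<Sum>i<r. a ^ i * A $$ (i, j)) = poly (t j) a"
      using eval_t[of id j a] j by (simp add: A_def mult.commute)
    also have "\<dots> = poly h a * a ^ j - poly f a * poly (q j) a"
      using arg_cong[OF qt(1)[of j], of "\<lambda>p. poly p a"] by (simp add: poly_monom)
    finally show "m dvd (\<Sum>i<r. a ^ i * A $$ (i, j))" using fa ha by simp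
  qed (use r_pos in auto)
  then show ?thesis using norm by blast
qed

end
end

text \<open>What the counting argument has to know about \<open>F\<close>. The integer \<open>E\<close> is a common denominator of the
generators \<open>\<omega> i\<close> of the lattice with respect to the powers of \<open>\<theta>\<close>, and \<open>h i\<close> represents
\<open>E * \<omega> i\<close>. Thus the sum with coefficients \<open>d i\<close> is the image of the vector \<open>d\<close> under \<open>\<theta> \<mapsto> a\<close>,
up to the factor \<open>E\<close>.\<close>

lemma norm_form_arithmetic:
  assumes K: "number_field K" and r: "degree_nf K = r" "r \<ge> 2" and F: "norm_form K F"
  shows "\<exists>f h u v D E C. lead_coeff f = 1 \<and> degree f = r \<and> u * f + v * pderiv f = [:D:] \<and> D \<noteq> 0 \<and> E > 0 \<and> C > 0 \<and>
    (\<forall>d m a. coprime m (int E) \<longrightarrow> m dvd poly f a \<longrightarrow> m dvd (\<Sum>i = 1..r. d i * poly (h i) a) \<longrightarrow> m dvd eval_mpoly F d) \<and>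
    (\<forall>s d. eval_mpoly F (\<lambda>i. s * d i) = s ^ r * eval_mpoly F d) \<and>
    (\<forall>d d'. (\<forall>i\<in>{1..r}. d i = d' i) \<longrightarrow> eval_mpoly F d = eval_mpoly F d') \<and>
    (\<forall>d N. (\<forall>i\<in>{1..r}. \<bar>d i\<bar> \<le> int N) \<longrightarrow> \<bar>eval_mpoly F d\<bar> \<le> int (C * N ^ r))"
proof -
  obtain \<theta> f where \<theta>: "\<theta> \<in> K" "integral_generator K \<theta> f" using integral_generator_exists[OF K] by blast
  have f: "lead_coeff f = 1" "degree f = r" using \<theta>(2) r unfolding integral_generator_def by auto
  obtain u v D where bez: "u * f + v * pderiv f = [:D:]" "D \<noteq> 0"
    using integral_generator_separable[OF K \<theta>(2)] f r by force
  from F[unfolded norm_form_def r(1) ring_of_integers_def] obtain \<omega>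
    where \<omega>0: "\<forall>i\<in>{1..r}. \<omega> i \<in> {x \<in> K. algebraic_int x}"
    and F0: "\<forall>x. of_int (eval_mpoly F x) = field_norm K (\<Sum>i = 1..r. of_int (x i) * \<omega> i)"
    by blast
  have \<omega>: "\<omega> i \<in> K" if "i \<in> {1..r}" for i using \<omega>0 that by blast
  have F_eq: "of_int (eval_mpoly F x) = field_norm K (\<Sum>i = 1..r. of_int (x i) * \<omega> i)" for x
    using F0 by blast
  have r1: "r \<ge> 1" using r by simp
  have "\<exists>g. i \<in> {1..r} \<longrightarrow> \<omega> i = rat_eval g \<theta>" for i
    using \<omega>[of i] \<theta>(2) unfolding integral_generator_def rat_adjoin_def by blast
  then obtain g where g: "\<And>i. i \<in> {1..r} \<Longrightarrow> \<omega> i = rat_eval (g i) \<theta>" by metis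
  obtain e :: int where e: "e > 0" "\<And>i. i \<in> {1..r} \<Longrightarrow> \<exists>h. of_int_poly h = smult (of_int e) (g i)"
    using clear_denominators[of "g ` {1..r}"] by auto
  then obtain h where h: "\<And>i. i \<in> {1..r} \<Longrightarrow> of_int_poly (h i) = smult (of_int e) (g i)" by metis
  have h_eval: "int_eval (h i) \<theta> = of_int e * \<omega> i" if "i \<in> {1..r}" for i
    unfolding rat_eval_of_int_poly[symmetric] h[OF that] g[OF that] by (simp add: rat_eval_simps)
  have sum_in: "(\<Sum>i = 1..r. of_int (d i) * \<omega> i) \<in> K" for d :: "nat \<Rightarrow> int"
  proof (intro number_field_sum[OF K] number_field_mult[OF K] \<omega>)
    show "of_int (d i) \<in> K" for i using number_field_of_rat[OF K, of "of_int (d i)"] by simp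
  qed
  have norm_scale: "of_int (eval_mpoly F (\<lambda>i. s * d i)) = (of_int s ^ r * of_int (eval_mpoly F d) :: rat)" for s d
  proof -
    have "(\<Sum>i = 1..r. of_int (s * d i) * \<omega> i) = of_rat (of_int s) * (\<Sum>i = 1..r. of_int (d i) * \<omega> i)"
      by (simp add: sum_distrib_left mult.assoc)
    then show ?thesis unfolding F_eq using field_norm_of_rat_mult[OF K sum_in, of "of_int s" d] r by simp
  qed
  have scale: "eval_mpoly F (\<lambda>i. s * d i) = s ^ r * eval_mpoly F d" for s d
    using norm_scale[of s d] by (metis of_int_eq_iff of_int_mult of_int_power)
  have dvd: "m dvd eval_mpoly F d"
    if m: "coprime m e" "m dvd poly f a" "m dvd (\<Sum>i = 1..r. d i * poly (h i) a)" for d m a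
  proof -
    let ?h = "\<Sum>i = 1..r. smult (d i) (h i)"
    have "int_eval ?h \<theta> = (\<Sum>i = 1..r. of_int (e * d i) * \<omega> i)"
      using h_eval by (auto simp: of_int_poly_hom.hom_sum poly_sum of_int_hom.map_poly_hom_smult intro!: sum.cong)
    then have "of_int (eval_mpoly F (\<lambda>i. e * d i)) = field_norm K (int_eval ?h \<theta>)" by (simp only: F_eq)
    moreover have "m dvd poly ?h a" using m(3) by (simp add: poly_sum)
    ultimately have "m dvd eval_mpoly F (\<lambda>i. e * d i)"
      using field_norm_int_eval_dvd[OF K \<theta>(2) r(1) r1 m(2)] by (metis of_int_eq_iff)
    then have "m dvd e ^ r * eval_mpoly F d" unfolding scale .
    moreover have "coprime m (e ^ r)" using m(1) by simp
    ultimately show ?thesis by (simp add: coprime_dvd_mult_right_iff)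
  qed
  have cong: "eval_mpoly F d = eval_mpoly F d'" if "\<forall>i\<in>{1..r}. d i = d' i" for d d'
  proof -
    have "(\<Sum>i = 1..r. of_int (d i) * \<omega> i) = (\<Sum>i = 1..r. of_int (d' i) * \<omega> i)"
      using that by (intro sum.cong) auto
    then have "of_int (eval_mpoly F d) = (of_int (eval_mpoly F d') :: rat)" unfolding F_eq by simp
    then show ?thesis by simp
  qed
  obtain C0 where C0: "C0 > 0" "\<And>d N. N \<ge> 0 \<Longrightarrow> \<forall>k\<in>{1..r}. \<bar>d k\<bar> \<le> N \<Longrightarrow>
    \<bar>field_norm K (\<Sum>k\<in>{1..r}. of_rat (d k) * \<omega> k)\<bar> \<le> C0 * N ^ degree_nf K"
    using abs_field_norm_linear_le[OF K, of "{1..r}" \<omega>] \<omega> by auto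
  define C where "C = nat \<lceil>C0\<rceil>"
  have C: "C > 0" "C0 \<le> of_nat C" using C0(1) by (auto simp: C_def)
  have bound: "\<bar>eval_mpoly F d\<bar> \<le> int (C * N ^ r)" if "\<forall>i\<in>{1..r}. \<bar>d i\<bar> \<le> int N" for d N
  proof -
    have "\<bar>of_int (d k)\<bar> \<le> (of_nat N :: rat)" if "k \<in> {1..r}" for k
      using \<open>\<forall>i\<in>{1..r}. \<bar>d i\<bar> \<le> int N\<close> that by (metis of_int_abs of_int_le_iff of_int_of_nat_eq)
    then have "\<bar>field_norm K (\<Sum>k\<in>{1..r}. of_rat (of_int (d k)) * \<omega> k)\<bar> \<le> C0 * of_nat N ^ degree_nf K"
      by (intro C0) auto
    also have "\<dots> \<le> of_nat C * of_nat N ^ r" using C r by (simp add: mult_right_mono)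
    finally have "\<bar>of_int (eval_mpoly F d) :: rat\<bar> \<le> of_nat (C * N ^ r)" unfolding F_eq by simp
    then have "(of_int \<bar>eval_mpoly F d\<bar> :: rat) \<le> of_int (int (C * N ^ r))" by simp
    then show ?thesis by (simp only: of_int_le_iff)
  qed
  show ?thesis
  proof (intro exI conjI)
    show "u * f + v * pderiv f = [:D:]" by (rule bez)
    show "nat e > 0" using e by simp
    show "C > 0" by (rule C)
    show "\<forall>d m a. coprime m (int (nat e)) \<longrightarrow> m dvd poly f a \<longrightarrow> m dvd (\<Sum>i = 1..r. d i * poly (h i) a) \<longrightarrow> m dvd eval_mpoly F d"
      using dvd e(1) by simp
  qed (use f bez scale cong bound in blast)+
qed

section \<open>Sets with few representations by a norm form\<close>

lemma le_of_square_le: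
  fixes x Q Y Z :: real
  assumes "x\<^sup>2 \<le> Q * x + Y + Z" "Q \<ge> 0" "Y \<ge> 0" "Z \<ge> 0"
  shows "x \<le> Q + sqrt Y + sqrt Z"
proof (rule ccontr)
  assume "\<not> ?thesis"
  then have x: "x - Q > sqrt Y + sqrt Z" by simp
  have s: "sqrt Y + sqrt Z \<ge> 0" using assms by simp
  have "Y + Z \<le> (sqrt Y + sqrt Z) * (sqrt Y + sqrt Z)"
    using assms by (simp add: algebra_simps)
  also have "\<dots> \<le> (sqrt Y + sqrt Z) * (x - Q)" using x s by (intro mult_left_mono) auto
  also have "\<dots> < x * (x - Q)"
    by (rule mult_strict_right_mono) (use x s assms(2) in linarith)+
  finally show False using assms(1) by (simp add: algebra_simps power2_eq_square)
qed

theorem theorem1p10: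
  fixes K :: "'k::field_char_0 set" and F :: int_mpoly and r :: nat
  assumes "number_field K" and "degree_nf K = r" and "r \<ge> 2"
    and "norm_form K F"
  shows "\<exists>c > 0. \<exists>C > 0. \<forall>N \<ge> (3::nat). \<forall>B \<ge> (1::real). \<forall>A \<subseteq> grid r N.
    (\<forall>q :: int. real (rep_count A F q) \<le> B) \<longrightarrow>
    real (card A) \<le> C * sqrt B * real N powr (real r / 2)
                     * exp (- c * (ln (real N) / ln (ln (real N))))"
proof -
  obtain f h u v D E C where f: "lead_coeff f = 1" "degree f = r"
    and bez: "u * f + v * pderiv f = [:D:]" "D \<noteq> 0" and E: "E > 0" and C: "C > 0"
    and dvd: "\<And>d m a. coprime m (int E) \<Longrightarrow> m dvd poly f a \<Longrightarrow>
       m dvd (\<Sum>i = 1..r. d i * poly (h i) a) \<Longrightarrow> m dvd eval_mpoly F d"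
    and scale: "\<And>s d. eval_mpoly F (\<lambda>i. s * d i) = s ^ r * eval_mpoly F d"
    and cong: "\<And>d d'. \<forall>i\<in>{1..r}. d i = d' i \<Longrightarrow> eval_mpoly F d = eval_mpoly F d'"
    and bound: "\<And>d N. \<forall>i\<in>{1..r}. \<bar>d i\<bar> \<le> int N \<Longrightarrow> \<bar>eval_mpoly F d\<bar> \<le> int (C * N ^ r)"
    using norm_form_arithmetic[OF assms] by blast
  define T where "T y = {p :: nat. prime p \<and> real p \<le> y \<and> \<not> p dvd E \<and> (\<exists>a. int p ^ r dvd poly f a)}" for y
  have "degree f \<ge> 2" "Suc (r - 1) = r" using assms(3) f by auto
  then obtain \<delta> where \<delta>: "\<delta> > 0" "\<forall>\<^sub>F y in at_top. y powr \<delta> \<le> card (T y)"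
    using many_primes_with_roots[OF f(1) _ bez E, of "r - 1"] unfolding T_def by auto
  have key: "(real (card A))\<^sup>2 \<le> real Q * real (card A) + B * real Q + 2 * B * real (C * N ^ r) * (3/4) ^ card P"
    if P: "P \<subseteq> T y" "finite P" and Q: "Q = (\<Prod>p\<in>P. p ^ r)" and A: "A \<subseteq> grid r N"
      and B: "\<forall>q. real (rep_count A F q) \<le> B" for P y and Q N :: nat and A and B :: real
  proof -
    have "\<forall>p\<in>P. \<exists>a. int p ^ r dvd poly f a" using P by (auto simp: T_def)
    then obtain a where a: "\<And>p. p \<in> P \<Longrightarrow> int p ^ r dvd poly f (a p)" by metis
    have prime: "prime p" if "p \<in> P" for p using that P by (auto simp: T_def)
    have coprime: "coprime (int p) (int E)" if "p \<in> P" for p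
      using that P prime[OF that] by (auto simp: T_def prime_imp_coprime)
    define L where "L p d = (\<Sum>i = 1..r. d i * poly (h i) (a p))" for p and d :: "nat \<Rightarrow> int"
    have div_p: "eval_mpoly F d = int p ^ r * eval_mpoly F (\<lambda>i. d i div int p)"
      if "\<forall>i\<in>{1..r}. int p dvd d i" for p :: nat and d
    proof -
      have "eval_mpoly F d = eval_mpoly F (\<lambda>i. int p * (d i div int p))"
        using that by (intro cong) auto
      then show ?thesis by (simp only: scale)
    qed
    show ?thesis unfolding Q
    proof (rule card_le_two_lattices[where \<Phi> = "eval_mpoly F" and L = L and r = r and P = P and X = "C * N ^ r"])
      show "finite A" using A by (rule finite_subset) (auto simp: grid_def intro!: finite_PiE)
      show "L p (\<lambda>i. a i - b i) = L p a - L p b" for p a b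
        by (simp add: L_def sum_subtractf left_diff_distrib)
      show "int p ^ r dvd eval_mpoly F d" if "p \<in> P" "int p ^ r dvd L p d" for p d
        using that a coprime by (intro dvd[of "int p ^ r" "a p"]) (auto simp: L_def)
      show "int p ^ r dvd eval_mpoly F d" if "p \<in> P" "\<forall>i\<in>{1..r}. int p dvd d i" for p d
        using div_p[OF that(2)] by simp
      show "int p ^ Suc r dvd eval_mpoly F d"
        if p: "p \<in> P" and L: "int p ^ r dvd L p d" and d: "\<forall>i\<in>{1..r}. int p dvd d i" for p d
      proof -
        have dvd2: "int p * int p dvd int p ^ r"
          using assms(3) le_imp_power_dvd[of 2 r "int p"] by (simp add: power2_eq_square)
        have dvd1: "int p dvd int p ^ r" using assms(3) by (intro dvd_power) simp
        \<comment> \<open>Dividing \<open>d\<close> by \<open>p\<close> leaves one factor \<open>p\<close> in \<open>L p\<close> because \<open>r \<ge> 2\<close>.\<close>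
        have "L p d = int p * L p (\<lambda>i. d i div int p)"
          unfolding L_def sum_distrib_left using d by (intro sum.cong) auto
        then have "int p * int p dvd int p * L p (\<lambda>i. d i div int p)"
          using dvd_trans[OF dvd2 L] by simp
        then have "int p dvd L p (\<lambda>i. d i div int p)" using prime[OF p] by (simp add: prime_gt_0_nat)
        moreover have "int p dvd poly f (a p)" using dvd_trans[OF dvd1 a[OF p]] .
        ultimately have "int p dvd eval_mpoly F (\<lambda>i. d i div int p)"
          using coprime[OF p] by (intro dvd[of "int p" "a p"]) (auto simp: L_def)
        then show ?thesis unfolding div_p[OF d] by (simp add: mult_dvd_mono mult.commute)
      qed
      show "\<bar>eval_mpoly F (\<lambda>i. a i - b i)\<bar> \<le> int (C * N ^ r)" if "a \<in> A" "b \<in> A" for a b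
      proof (rule bound, rule ballI)
        fix i assume i: "i \<in> {1..r}"
        have "a i \<in> {1..int N}" "b i \<in> {1..int N}"
          using i that A unfolding grid_def by (meson PiE_mem subsetD)+
        then show "\<bar>a i - b i\<bar> \<le> int N" by auto
      qed
      show "real (card {(a, b). a \<in> A \<and> b \<in> A \<and> a \<noteq> b \<and> eval_mpoly F (\<lambda>i. a i - b i) = q}) \<le> B" for q
        using B unfolding rep_count_def by blast
    qed (use P prime in auto)
  qed
  have r0: "real r \<ge> 2" using assms(3) by simp
  \<comment> \<open>The square root of \<open>(3/4) ^ k\<close> is \<open>exp (- \<kappa> * k)\<close>.\<close>
  define \<kappa> where "\<kappa> = ln (4/3 :: real) / 2"
  have \<kappa>: "\<kappa> > 0" by (simp add: \<kappa>_def)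
  define c where "c = min (\<kappa> * \<delta> / (2 * real r)) (1 / 2)"
  have c: "c > 0" "c \<le> \<kappa> * \<delta> / (2 * real r)" "c \<le> 1 / 2" using \<kappa> \<delta>(1) r0 by (auto simp: c_def)
  define C1 where "C1 = 2 + sqrt (2 * C) * exp \<kappa>"
  have C1: "C1 > 0" by (simp add: C1_def add_pos_nonneg)
  define g where "g N = exp (- c * (ln (real N) / ln (ln (real N))))" for N :: nat
  have "\<forall>\<^sub>F N in sequentially. \<forall>B\<ge>1. \<forall>A\<subseteq>grid r N. (\<forall>q. real (rep_count A F q) \<le> B) \<longrightarrow>
      real (card A) \<le> C1 * sqrt B * real N powr (real r / 2) * g N"
  proof -
    have lim: "filterlim (\<lambda>N :: nat. ln (real N) powr (1 / \<delta>)) at_top sequentially"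
      using \<delta>(1) by real_asymp
    have ev1: "\<forall>\<^sub>F N in sequentially. ln (ln (real N)) \<ge> 1" by real_asymp
    have ev2: "\<forall>\<^sub>F N in sequentially. ln (ln (real N)) \<ge> \<delta> / (2 * real r)" by real_asymp
    have ev3: "\<forall>\<^sub>F N in sequentially. ln (real N) \<ge> 1" by real_asymp
    show ?thesis
      using eventually_compose_filterlim[OF \<delta>(2) lim] ev1 ev2 ev3
    proof eventually_elim
      case (elim N)
      define l where "l = ln (real N)"
      define ll where "ll = ln l"
      have l: "l \<ge> 1" and ll: "ll \<ge> 1" "ll \<ge> \<delta> / (2 * real r)" using elim by (simp_all add: l_def ll_def)
      have N: "real N > 0" using l by (cases "N = 0") (auto simp: l_def)
      \<comment> \<open>There are at least \<open>y powr \<delta> = ln N \<ge> k\<close> suitable primes up to \<open>y\<close>, and \<open>k\<close> is the largest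
        integer for which \<open>Q \<le> y ^ (r * k)\<close> ensures \<open>Q \<le> sqrt N\<close>.\<close>
      define y where "y = l powr (1 / \<delta>)"
      define k where "k = nat \<lfloor>\<delta> * l / (2 * real r * ll)\<rfloor>"
      have pos: "\<delta> * l / (2 * real r * ll) \<ge> 0" using \<delta> l ll r0 by simp
      have k_le: "real k \<le> \<delta> * l / (2 * real r * ll)" using pos by (simp add: k_def)
      have k_ge: "real k + 1 \<ge> \<delta> * l / (2 * real r * ll)" using pos unfolding k_def by linarith
      have "\<delta> * l / (2 * real r * ll) = (\<delta> / (2 * real r)) / ll * l" by simp
      also have "\<dots> \<le> 1 * l"
      proof (rule mult_right_mono)
        have "ll > 0" using ll(1) by linarith
        then show "\<delta> / (2 * real r) / ll \<le> 1" using ll(2) by (subst divide_le_eq_1_pos)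
      qed (use l in simp)
      also have "1 * l = y powr \<delta>" using l \<delta>(1) by (simp add: y_def powr_powr)
      finally have "real k \<le> y powr \<delta>" using k_le by linarith
      also have "\<dots> \<le> card (T y)" using elim(1) by (simp add: y_def l_def)
      finally have "k \<le> card (T y)" by simp
      then obtain P where P: "P \<subseteq> T y" "card P = k" "finite P" using obtain_subset_with_card_n by metis
      define Q where "Q = (\<Prod>p\<in>P. p ^ r)"
      have y1: "y \<ge> 1" unfolding y_def using l \<delta>(1) by (intro ge_one_powr_ge_zero) auto
      have "real Q = (\<Prod>p\<in>P. real p ^ r)" by (simp add: Q_def)
      also have "\<dots> \<le> (\<Prod>p\<in>P. y ^ r)" using P(1) by (intro prod_mono) (auto simp: T_def intro!: power_mono)
      also have "\<dots> = y ^ (r * k)" by (simp add: P(2) power_mult)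
      also have "\<dots> = y powr real (r * k)" using y1 by (subst powr_realpow) auto
      also have "\<dots> = exp (real (r * k) * (ll / \<delta>))"
      proof -
        have "ln y = ll / \<delta>" using l by (simp add: y_def ln_powr ll_def)
        then show ?thesis using y1 by (simp add: powr_def)
      qed
      also have "\<dots> \<le> exp (l / 2)"
      proof -
        have "real r * real k \<le> real r * (\<delta> * l / (2 * real r * ll))"
          by (rule mult_left_mono[OF k_le]) simp
        then have "real (r * k) \<le> real r * (\<delta> * l / (2 * real r * ll))" by (simp only: of_nat_mult)
        then have "real (r * k) * (ll / \<delta>) \<le> real r * (\<delta> * l / (2 * real r * ll)) * (ll / \<delta>)"
          by (rule mult_right_mono) (use ll \<delta>(1) in auto)
        also have "\<dots> = l / 2" using r0 ll \<delta>(1) by (simp add: field_simps)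
        finally show ?thesis by simp
      qed
      finally have Q_le: "real Q \<le> exp (l / 2)" .
      have Q1: "Q \<ge> 1" unfolding Q_def Suc_le_eq One_nat_def using P(1)
        by (intro prod_pos) (auto simp: T_def prime_gt_0_nat)
      have g: "g N = exp (- c * (l / ll))" by (simp add: g_def l_def ll_def)
      have Nr: "real N powr (real r / 2) = exp (l * r / 2)" using N by (simp add: powr_def l_def mult.commute)
      have Q_final: "real Q \<le> real N powr (real r / 2) * g N"
      proof -
        have "c * (l / ll) \<le> 1 / 2 * (l / 1)"
          using c l ll by (intro mult_mono divide_left_mono) auto
        moreover have "l * 2 \<le> l * r" using r0 l by (intro mult_left_mono) auto
        ultimately have "l / 2 \<le> l * r / 2 + - c * (l / ll)" by linarith
        then have "exp (l / 2) \<le> exp (l * r / 2 + - c * (l / ll))" by simp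
        then show ?thesis using Q_le unfolding Nr g exp_add[symmetric] by linarith
      qed
      have geo: "sqrt ((3/4) ^ k) \<le> exp \<kappa> * g N"
      proof -
        have "(3/4 :: real) ^ k = exp (ln (3/4) * k)" by (simp add: exp_of_nat_mult mult.commute)
        also have "ln (3/4 :: real) = - (2 * \<kappa>)" by (simp add: \<kappa>_def ln_div field_simps)
        also have "exp (- (2 * \<kappa>) * k) = (exp (- \<kappa> * k))\<^sup>2" by (simp flip: exp_double)
        finally have "sqrt ((3/4) ^ k) = exp (- \<kappa> * k)" by simp
        also have "- \<kappa> * k \<le> \<kappa> + - c * (l / ll)"
        proof -
          have "c * (l / ll) \<le> \<kappa> * \<delta> / (2 * real r) * (l / ll)" using c l ll by (intro mult_right_mono) auto
          also have "\<dots> = \<kappa> * (\<delta> * l / (2 * real r * ll))" by simp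
          also have "\<dots> \<le> \<kappa> * (real k + 1)" using k_ge \<kappa> by (intro mult_left_mono) auto
          finally show ?thesis by (simp add: algebra_simps)
        qed
        finally show ?thesis unfolding g exp_add[symmetric] by simp
      qed
      show ?case
      proof (intro allI impI)
        fix B :: real and A assume B: "B \<ge> 1" and A: "A \<subseteq> grid r N" and rep: "\<forall>q. real (rep_count A F q) \<le> B"
        let ?Z = "2 * B * real (C * N ^ r) * (3/4) ^ k"
        let ?R = "sqrt B * (real N powr (real r / 2) * g N)"
        have "real (card A) \<le> Q + sqrt (B * Q) + sqrt ?Z"
          using key[OF P(1,3) Q_def A rep] B unfolding P(2) by (intro le_of_square_le) auto
        moreover have "real Q \<le> ?R"
        proof -
          have "real Q \<le> sqrt B * Q" using B Q1 by simp
          also have "\<dots> \<le> ?R" using B by (intro mult_left_mono Q_final) auto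
          finally show ?thesis .
        qed
        moreover have "sqrt (B * Q) \<le> ?R"
        proof -
          have "sqrt Q \<le> Q" using Q1 by (intro real_le_lsqrt) (auto simp: power2_eq_square)
          then have "sqrt (B * Q) \<le> sqrt B * Q" using B by (simp add: real_sqrt_mult mult_left_mono)
          also have "\<dots> \<le> ?R" using B by (intro mult_left_mono Q_final) auto
          finally show ?thesis .
        qed
        moreover have "sqrt ?Z \<le> sqrt (2 * C) * exp \<kappa> * ?R"
        proof -
          have "sqrt (real N ^ r) = real N powr (real r / 2)"
            using N by (simp add: powr_half_sqrt[symmetric] powr_powr flip: powr_realpow)
          then have "sqrt ?Z = sqrt B * sqrt (2 * C) * real N powr (real r / 2) * sqrt ((3/4) ^ k)"
            by (simp add: real_sqrt_mult)
          also have "\<dots> \<le> sqrt B * sqrt (2 * C) * real N powr (real r / 2) * (exp \<kappa> * g N)"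
            using B by (intro mult_left_mono geo) auto
          finally show ?thesis by (simp only: mult_ac)
        qed
        ultimately have "real (card A) \<le> C1 * ?R" unfolding C1_def distrib_right by linarith
        then show "real (card A) \<le> C1 * sqrt B * real N powr (real r / 2) * g N" by (simp only: mult_ac)
      qed
    qed
  qed
  then obtain N0 where "\<forall>N\<ge>N0. \<forall>B\<ge>1. \<forall>A\<subseteq>grid r N. (\<forall>q. real (rep_count A F q) \<le> B) \<longrightarrow>
      real (card A) \<le> C1 * sqrt B * real N powr (real r / 2) * g N"
    unfolding eventually_sequentially by (elim exE)
  then have N0: "real (card A) \<le> C1 * sqrt B * real N powr (real r / 2) * g N"
    if "N \<ge> N0" "B \<ge> 1" "A \<subseteq> grid r N" "\<forall>q. real (rep_count A F q) \<le> B" for N B A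
    using that by simp
  \<comment> \<open>For the finitely many \<open>N < N0\<close>, the trivial bound \<open>card A \<le> N ^ r\<close> is absorbed by the constant.\<close>
  define C2 where "C2 = C1 + (\<Sum>N<N0. real N ^ r / g N)"
  have g_pos: "g N > 0" for N by (simp add: g_def)
  have C2: "C2 \<ge> C1" unfolding C2_def using g_pos by (simp add: sum_nonneg less_imp_le)
  show ?thesis
  proof (rule exI[of _ c], rule conjI[OF c(1)], rule exI[of _ C2], rule conjI, goal_cases)
    case 1
    show ?case using C1 C2 by linarith
  next
    case 2
    show ?case
    proof (intro allI impI)
      fix N :: nat and B :: real and A
      assume N: "N \<ge> 3" and B: "B \<ge> 1" and A: "A \<subseteq> grid r N" and rep: "\<forall>q. real (rep_count A F q) \<le> B"
      have "real (card A) \<le> C2 * sqrt B * real N powr (real r / 2) * g N"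
      proof (cases "N \<ge> N0")
        case True
        have "real (card A) \<le> C1 * sqrt B * real N powr (real r / 2) * g N" by (rule N0[OF True B A rep])
        also have "\<dots> \<le> C2 * sqrt B * real N powr (real r / 2) * g N"
          using C2 B g_pos[of N] by (intro mult_right_mono) auto
        finally show ?thesis .
      next
        case False
        have "card A \<le> card (grid r N)" using A by (intro card_mono) (auto simp: grid_def intro!: finite_PiE)
        also have "\<dots> = N ^ r" by (simp add: grid_def card_PiE)
        finally have "real (card A) \<le> real N ^ r" by (metis of_nat_le_iff of_nat_power)
        also have "\<dots> = real N ^ r / g N * 1 * 1 * g N" using g_pos[of N] by simp
        also have "\<dots> \<le> C2 * sqrt B * real N powr (real r / 2) * g N"
        proof (intro mult_right_mono mult_mono)
          have "real N ^ r / g N \<le> (\<Sum>N<N0. real N ^ r / g N)"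
            using False g_pos by (intro member_le_sum) (auto simp: less_imp_le)
          then show "real N ^ r / g N \<le> C2" using C1 by (simp add: C2_def)
          show "1 \<le> real N powr (real r / 2)" using N by (intro ge_one_powr_ge_zero) auto
        qed (use B C1 C2 g_pos[of N] in auto)
        finally show ?thesis .
      qed
      then show "real (card A) \<le> C2 * sqrt B * real N powr (real r / 2) * exp (- c * (ln (real N) / ln (ln (real N))))"
        by (simp add: g_def)
    qed
  qed
qed

end
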